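(* Let $A\in\mathbb{R}^{m\times n}$ have rank $\rho$, let $1\le k<\rho$ be a target rank, and let $\ell>k$ be an integer. Fix an SVD of $A$, with associated leverage scores $s_1^*,\ldots,s_n^*$ relative to rank $k$. Let $\mathbf{s}=(s_1,\ldots,s_n)$ be admissible sampling scores (so $\sum_{i=1}^n s_i=k$), and let $C\in\mathbb{R}^{m\times \ell}$ be the random matrix whose columns are $\ell$ columns of $A$ drawn independently with replacement, the $i$-th column being chosen in each draw with probability $s_i/k$. Let $\delta\in(0,1)$. Then, with probability at least $1-\delta-2k\exp\left(-\ell/[8k\,c(\mathbf{s})]\right)$, $$\|A-\Pi^2_{C,k}(A)\|_2\le \sigma_{k+1}\,(1+\epsilon(\mathbf{s})),$$ where $$\epsilon(\mathbf{s})=3\left[\sqrt{c(\mathbf{s})\,\frac{k(\rho+1-k)\log(\rho/\delta)}{\ell}}+q(\mathbf{s})\,\frac{k\log(\rho/\delta)}{\ell}\right]$$ and $\sigma_{k+1}$ is the $(k+1)$-th largest singular value of $A$.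
   Context: SVD: write $A=U\begin{pmatrix}\Sigma_1 & 0 \\ 0 & \Sigma_2\end{pmatrix}\begin{pmatrix} V_1^\top \\ V_2^\top \end{pmatrix}$, a thin SVD with singular values in descending order, where $\Sigma_1\in\mathbb{R}^{k\times k}$, $\Sigma_2\in\mathbb{R}^{(\rho-k)\times(\rho-k)}$, $V_1\in\mathbb{R}^{n\times k}$, $V_2\in\mathbb{R}^{n\times(\rho-k)}$, and $U$, $(V_1, V_2)$ have orthonormal columns. Leverage scores: write $V_1^\top=(\mathbf{v}_1,\ldots,\mathbf{v}_n)\in\mathbb{R}^{k\times n}$. The statistical leverage scores of $A$ relative to rank $k$ are $s_i^*=\|\mathbf{v}_i\|_2^2$; they satisfy $\sum_{i=1}^n s_i^*=k$. Admissible sampling scores: $\mathbf{s}=(s_1,\ldots,s_n)$ with $s_i\ge 0$, $\sum_{i=1}^n s_i=k$, and $s_i>0$ whenever $s_i^*>0$. Quantities (with the convention $0/0=0$): $c(\mathbf{s})=\max_{1\le i\le n}\frac{s_i^*}{s_i}$ and $q(\mathbf{s})=\max_{1\le i\le n}\frac{\sqrt{s_i^*}}{s_i}$. $\Pi^2_{C,k}(A)$ denotes a best spectral-norm approximation to $A$ within the column space of $C$ of rank at most $k$, i.e. a minimizer of $\|A-X\|_2$ over all $X\in\mathbb{R}^{m\times n}$ whose columns lie in the column space of $C$ and with $\operatorname{rank}(X)\le k$. $\|\cdot\|_2$ is the spectral norm. *)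

theory Defs
  imports "HOL-Probability.Probability"
begin

definition spectral_norm :: "real^'n^'m \<Rightarrow> real" where
  "spectral_norm M = onorm (\<lambda>x. M *v x)"

text \<open>
  \<open>A = U diag(\<sigma>) V\<^sup>T\<close> with inner dimension \<open>r\<close>, written out entrywise. The factors \<open>U\<close> (\<open>m \<times> r\<close>) and
  \<open>V\<close> (\<open>n \<times> r\<close>) are given by their columns \<open>U p\<close>, \<open>V p\<close> for \<open>p < r\<close>, numbered from 0, so that
  \<open>V\<^sub>1\<close> consists of the columns \<open>p < k\<close> and \<open>\<sigma> k\<close> is the \<open>(k+1)\<close>-th largest singular value.
  Values at indices \<open>p \<ge> r\<close> are irrelevant.
\<close>

definition thin_svd ::
  "real^'n^'m \<Rightarrow> nat \<Rightarrow> (nat \<Rightarrow> real^'m) \<Rightarrow> (nat \<Rightarrow> real) \<Rightarrow> (nat \<Rightarrow> real^'n) \<Rightarrow> bool" where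
  "thin_svd A r U \<sigma> V \<longleftrightarrow>
     A = (\<chi> i j. \<Sum>p<r. U p $ i * \<sigma> p * V p $ j) \<and>
     (\<forall>p<r. \<forall>q<r. U p \<bullet> U q = (if p = q then 1 else 0)) \<and>
     (\<forall>p<r. \<forall>q<r. V p \<bullet> V q = (if p = q then 1 else 0)) \<and>
     (\<forall>p<r. 0 \<le> \<sigma> p) \<and>
     (\<forall>p<r. \<forall>q<r. p \<le> q \<longrightarrow> \<sigma> q \<le> \<sigma> p)"

text \<open>The squared Euclidean norm of the \<open>i\<close>-th row of \<open>V\<^sub>1\<close>, the first \<open>k\<close> columns of \<open>V\<close>.\<close>

definition leverage :: "(nat \<Rightarrow> real^'n) \<Rightarrow> nat \<Rightarrow> 'n \<Rightarrow> real" where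
  "leverage V k i = (L2_set (\<lambda>p. V p $ i) {..<k})\<^sup>2"

definition admissible :: "('n::finite \<Rightarrow> real) \<Rightarrow> nat \<Rightarrow> ('n \<Rightarrow> real) \<Rightarrow> bool" where
  "admissible lev k s \<longleftrightarrow>
     (\<forall>i. 0 \<le> s i) \<and> (\<Sum>i\<in>UNIV. s i) = real k \<and> (\<forall>i. 0 < lev i \<longrightarrow> 0 < s i)"

text \<open>
  For admissible \<open>s\<close> and leverage scores \<open>lev\<close>, the only zero denominators below come with a zero
  numerator, so division by zero in HOL realises exactly the convention \<open>0/0 = 0\<close>.
\<close>

definition c_score :: "('n::finite \<Rightarrow> real) \<Rightarrow> ('n \<Rightarrow> real) \<Rightarrow> real" where
  "c_score lev s = (MAX i. lev i / s i)"

definition q_score :: "('n::finite \<Rightarrow> real) \<Rightarrow> ('n \<Rightarrow> real) \<Rightarrow> real" where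
  "q_score lev s = (MAX i. sqrt (lev i) / s i)"

definition epsilon ::
  "('n::finite \<Rightarrow> real) \<Rightarrow> ('n \<Rightarrow> real) \<Rightarrow> nat \<Rightarrow> nat \<Rightarrow> nat \<Rightarrow> real \<Rightarrow> real" where
  "epsilon lev s \<rho> k l \<delta> =
     3 * (sqrt (c_score lev s * (real k * (real \<rho> + 1 - real k) * ln (real \<rho> / \<delta>) / real l))
          + q_score lev s * (real k * ln (real \<rho> / \<delta>) / real l))"

text \<open>
  The distribution of the column indices in \<open>CARD('l)\<close> independent draws with replacement. If \<open>s\<close> is
  nonnegative with sum \<open>k > 0\<close>, then \<open>\<lambda>i. s i / k\<close> is a probability mass function, as
  \<open>embed_pmf\<close> requires.
\<close>

definition draws :: "('n::finite \<Rightarrow> real) \<Rightarrow> nat \<Rightarrow> ('l::finite \<Rightarrow> 'n) pmf" where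
  "draws s k = Pi_pmf UNIV undefined (\<lambda>_. embed_pmf (\<lambda>i. s i / real k))"

definition sampled_columns :: "real^'n^'m \<Rightarrow> ('l::finite \<Rightarrow> 'n) \<Rightarrow> real^'l^'m" where
  "sampled_columns A \<omega> = (\<chi> i j. A $ i $ \<omega> j)"

text \<open>
  A minimiser need not be unique; \<open>best_approx\<close> is some minimiser. All minimisers have
  the same error \<open>spectral_norm (A - X)\<close>.
\<close>

definition best_approx :: "real^'l^'m \<Rightarrow> nat \<Rightarrow> real^'n^'m \<Rightarrow> real^'n^'m" where
  "best_approx C k A =
     (ARG_MIN (\<lambda>X. spectral_norm (A - X)) X. columns X \<subseteq> span (columns C) \<and> rank X \<le> k)"

end

theory Submission
  imports Defs "HOL-Real_Asymp.Real_Asymp"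
begin

text \<open>
  Let \<open>P\<^sub>1\<close> and \<open>P\<^sub>2\<close> be the orthogonal projections onto the spans of \<open>V\<^sub>1\<close> and \<open>V\<^sub>2\<close>, put
  \<open>w\<^sub>i = P\<^sub>1 e\<^sub>i\<close>, \<open>z\<^sub>i = P\<^sub>2 e\<^sub>i\<close>, and weight a drawn index \<open>i\<close> by \<open>r\<^sub>i = k / (l s\<^sub>i)\<close>. If the random
  Gram operator \<open>\<Sum> r w w\<^sup>T\<close> is at least \<open>1/2\<close> on the span of \<open>V\<^sub>1\<close> and the cross term \<open>\<Sum> r w z\<^sup>T\<close> has
  norm at most \<open>t\<close>, then an explicit matrix of rank at most \<open>k\<close> in the span of the sampled columns has
  error at most \<open>\<sigma>\<^sub>k (1 + 2 t)\<close> (indexing from 0).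

  The cross term has mean 0, and its Frobenius norm already has the right variance, so Pinelis's
  dimension-free Bernstein inequality in a Hilbert space bounds it; its factor 2 is absorbed by
  \<open>\<rho> \<ge> 2\<close>. The Gram operator needs a genuine matrix Chernoff bound. The exponential potential
  \<open>tr exp (- \<theta> S)\<close> is replaced by \<open>tr (1 - \<theta> S / n)\<^sup>n\<close>: because moment sequences \<open>m \<mapsto> w\<^sup>T B\<^sup>m w\<close> are
  log-convex, a telescoping expansion controls the effect of a rank-one step, and \<open>n \<rightarrow> \<infinity>\<close> gives the
  exponent \<open>1/8\<close>.
\<close>

section \<open>Orthonormal families\<close>

definition ortho_proj :: "('i \<Rightarrow> 'a::real_inner) \<Rightarrow> 'i set \<Rightarrow> 'a \<Rightarrow> 'a" where
  "ortho_proj V K x = (\<Sum>p\<in>K. (V p \<bullet> x) *\<^sub>R V p)"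

locale orthonormal_family =
  fixes V :: "'i \<Rightarrow> 'a::real_inner" and K :: "'i set"
  assumes finite: "finite K"
    and orthonormal: "\<lbrakk>p \<in> K; q \<in> K\<rbrakk> \<Longrightarrow> V p \<bullet> V q = (if p = q then 1 else 0)"
begin

abbreviation P :: "'a \<Rightarrow> 'a" where "P \<equiv> ortho_proj V K"

lemma linear_proj: "linear P"
  unfolding ortho_proj_def
  by (intro linearI) (simp_all add: inner_add_right algebra_simps sum.distrib scaleR_sum_right)

lemma inner_combination:
  assumes "p \<in> K"
  shows "V p \<bullet> (\<Sum>q\<in>K. c q *\<^sub>R V q) = c p"
proof -
  have "V p \<bullet> (\<Sum>q\<in>K. c q *\<^sub>R V q) = (\<Sum>q\<in>K. if p = q then c q else 0)"
    unfolding inner_sum_right using assms by (intro sum.cong) (auto simp: orthonormal)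
  then show ?thesis using finite assms by simp
qed

lemma norm_combination: "(norm (\<Sum>p\<in>K. c p *\<^sub>R V p))\<^sup>2 = (\<Sum>p\<in>K. (c p)\<^sup>2)"
proof -
  have "(norm (\<Sum>p\<in>K. c p *\<^sub>R V p))\<^sup>2 = (\<Sum>p\<in>K. c p * (V p \<bullet> (\<Sum>p\<in>K. c p *\<^sub>R V p)))"
    by (simp add: power2_norm_eq_inner inner_sum_left)
  also have "\<dots> = (\<Sum>p\<in>K. (c p)\<^sup>2)"
    by (intro sum.cong) (auto simp: inner_combination power2_eq_square)
  finally show ?thesis .
qed

lemma inner_proj_right: "y \<bullet> P x = (\<Sum>p\<in>K. (y \<bullet> V p) * (V p \<bullet> x))"
  by (simp add: ortho_proj_def inner_sum_right mult.commute)

lemma proj_sym: "P x \<bullet> y = x \<bullet> P y"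
  unfolding inner_proj_right by (subst inner_commute) (simp add: inner_proj_right inner_commute mult.commute)

lemma inner_basis_proj: "p \<in> K \<Longrightarrow> V p \<bullet> P x = V p \<bullet> x"
  by (simp add: ortho_proj_def inner_combination)

lemma proj_idem: "P (P x) = P x"
proof -
  have "P (P x) = (\<Sum>p\<in>K. (V p \<bullet> P x) *\<^sub>R V p)"
    by (rule ortho_proj_def)
  also have "\<dots> = P x"
    unfolding ortho_proj_def[of V K x] by (intro sum.cong) (simp_all flip: ortho_proj_def add: inner_basis_proj)
  finally show ?thesis .
qed

lemma norm_proj: "(norm (P x))\<^sup>2 = (\<Sum>p\<in>K. (V p \<bullet> x)\<^sup>2)"
  unfolding ortho_proj_def by (rule norm_combination)

lemma inner_proj_self: "x \<bullet> P x = (norm (P x))\<^sup>2"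
  by (metis power2_norm_eq_inner proj_idem proj_sym)

lemma norm_proj_le: "norm (P x) \<le> norm x"
proof (cases "P x = 0")
  case False
  have "norm (P x) * norm (P x) \<le> norm x * norm (P x)"
    using inner_proj_self[of x] norm_cauchy_schwarz[of x "P x"] by (simp add: power2_eq_square)
  then show ?thesis using False by simp
qed simp

lemma parseval: "P z = z \<Longrightarrow> (\<Sum>p\<in>K. (y \<bullet> V p) * (V p \<bullet> z)) = y \<bullet> z"
  using inner_proj_right[of y z] by simp

text \<open>Expand \<open>x\<close> in the family and apply Cauchy-Schwarz. For \<open>f\<close> a
  power \<open>B ^^ c\<close> of a symmetric operator, the sum on the right is the trace of
  \<open>B ^^ (c + c)\<close> on the span; this is how a single moment is compared with a
  trace.\<close>

lemma norm_le_frobenius: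
  fixes f :: "'a \<Rightarrow> 'b::real_normed_vector"
  assumes f: "linear f" and x: "P x = x"
  shows "(norm (f x))\<^sup>2 \<le> (norm x)\<^sup>2 * (\<Sum>p\<in>K. (norm (f (V p)))\<^sup>2)"
proof -
  have "f x = (\<Sum>p\<in>K. (V p \<bullet> x) *\<^sub>R f (V p))"
    by (subst x[symmetric]) (simp add: ortho_proj_def linear_sum[OF f] linear_scale[OF f])
  then have "norm (f x) \<le> (\<Sum>p\<in>K. \<bar>V p \<bullet> x\<bar> * norm (f (V p)))"
    using norm_sum[of "\<lambda>p. (V p \<bullet> x) *\<^sub>R f (V p)" K] by simp
  then have "(norm (f x))\<^sup>2 \<le> (\<Sum>p\<in>K. \<bar>V p \<bullet> x\<bar> * norm (f (V p)))\<^sup>2"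
    by (rule power_mono) simp
  also have "\<dots> \<le> (\<Sum>p\<in>K. \<bar>V p \<bullet> x\<bar>\<^sup>2) * (\<Sum>p\<in>K. (norm (f (V p)))\<^sup>2)"
    by (rule Cauchy_Schwarz_ineq_sum)
  also have "(\<Sum>p\<in>K. \<bar>V p \<bullet> x\<bar>\<^sup>2) = (norm x)\<^sup>2"
    using norm_proj[of x] x by simp
  finally show ?thesis .
qed

end

section \<open>Expectations over independent draws\<close>

lemma expectation_Pi_pmf_insert:
  fixes p :: "'i \<Rightarrow> ('b::finite) pmf" and \<Phi> :: "('i \<Rightarrow> 'b) \<Rightarrow> real"
  assumes "finite J" "j \<notin> J"
  shows "measure_pmf.expectation (Pi_pmf (insert j J) d p) \<Phi> =
    measure_pmf.expectation (Pi_pmf J d p) (\<lambda>\<omega>. measure_pmf.expectation (p j) (\<lambda>i. \<Phi> (fun_upd \<omega> j i)))"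
proof -
  have fin: "finite (set_pmf (Pi_pmf J d p))"
    using set_Pi_pmf_subset'[OF assms(1)] finite_PiE_dflt[OF assms(1)] by (meson finite finite_subset)
  \<comment> \<open>Commuting the two draws puts coordinate \<open>j\<close> innermost, so that it
    is averaged with the other coordinates held fixed.\<close>
  have "Pi_pmf (insert j J) d p = Pi_pmf J d p \<bind> (\<lambda>\<omega>. map_pmf (\<lambda>i. fun_upd \<omega> j i) (p j))"
    unfolding Pi_pmf_insert'[OF assms] map_pmf_def by (rule bind_commute_pmf)
  also have "measure_pmf.expectation \<dots> \<Phi> =
     (\<Sum>\<omega>\<in>set_pmf (Pi_pmf J d p). pmf (Pi_pmf J d p) \<omega> *\<^sub>R
       measure_pmf.expectation (map_pmf (\<lambda>i. fun_upd \<omega> j i) (p j)) \<Phi>)"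
    using fin by (intro pmf_expectation_bind) auto
  also have "\<dots> = measure_pmf.expectation (Pi_pmf J d p)
       (\<lambda>\<omega>. measure_pmf.expectation (p j) (\<lambda>i. \<Phi> (fun_upd \<omega> j i)))"
    using fin by (subst integral_measure_pmf[OF fin]) auto
  finally show ?thesis .
qed

text \<open>Supermartingale argument: the draws are revealed one at a time, and each multiplies the
  conditional mean of the potential by at most \<open>\<kappa>\<close>. The Chernoff and the
  Bernstein bound both rest on it, with different potentials.\<close>

lemma expectation_Pi_pmf_le_power:
  fixes p :: "'i \<Rightarrow> ('b::finite) pmf" and \<Phi> :: "'i set \<Rightarrow> ('i \<Rightarrow> 'b) \<Rightarrow> real"
  assumes "finite J" and "0 \<le> \<kappa>"
    and step: "\<And>J' j \<omega>. \<lbrakk>J' \<subseteq> J; j \<in> J; j \<notin> J'\<rbrakk> \<Longrightarrow>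
      measure_pmf.expectation (p j) (\<lambda>i. \<Phi> (insert j J') (fun_upd \<omega> j i)) \<le> \<kappa> * \<Phi> J' \<omega>"
  shows "measure_pmf.expectation (Pi_pmf J d p) (\<Phi> J) \<le> \<kappa> ^ card J * \<Phi> {} (\<lambda>_. d)"
  using assms(1) step
proof (induction J rule: finite_induct)
  case (insert j J)
  have fin: "finite (set_pmf (Pi_pmf J d p))"
    using set_Pi_pmf_subset'[OF insert.hyps(1)] finite_PiE_dflt[OF insert.hyps(1)] by (meson finite finite_subset)
  have int: "integrable (measure_pmf (Pi_pmf J d p)) f" for f :: "_ \<Rightarrow> real"
    by (rule integrable_measure_pmf_finite[OF fin])
  have "measure_pmf.expectation (Pi_pmf (insert j J) d p) (\<Phi> (insert j J))
      = measure_pmf.expectation (Pi_pmf J d p)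
          (\<lambda>\<omega>. measure_pmf.expectation (p j) (\<lambda>i. \<Phi> (insert j J) (fun_upd \<omega> j i)))"
    by (rule expectation_Pi_pmf_insert[OF insert.hyps(1,2)])
  also have "\<dots> \<le> measure_pmf.expectation (Pi_pmf J d p) (\<lambda>\<omega>. \<kappa> * \<Phi> J \<omega>)"
    using insert.hyps(2) by (intro integral_mono int insert.prems) auto
  also have "\<dots> = \<kappa> * measure_pmf.expectation (Pi_pmf J d p) (\<Phi> J)"
    by simp
  also have "\<dots> \<le> \<kappa> * (\<kappa> ^ card J * \<Phi> {} (\<lambda>_. d))"
    using insert.prems by (intro mult_left_mono insert.IH \<open>0 \<le> \<kappa>\<close>) auto
  finally show ?case
    using insert.hyps by simp
qed simp

lemma expectation_finite_pmf:
  fixes q :: "'b::finite pmf" and f :: "'b \<Rightarrow> real"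
  shows "measure_pmf.expectation q f = (\<Sum>i\<in>UNIV. pmf q i * f i)"
  by (subst integral_measure_pmf[of UNIV]) auto

text \<open>Markov's inequality; on a finite sample space every function is integrable.\<close>

lemma prob_le_expectation:
  fixes M :: "'b::finite pmf" and \<Phi> :: "'b \<Rightarrow> real"
  assumes t: "0 < t" and nn: "\<And>\<omega>. 0 \<le> \<Phi> \<omega>" and ge: "\<And>\<omega>. \<omega> \<in> E \<Longrightarrow> t \<le> \<Phi> \<omega>"
  shows "measure_pmf.prob M E \<le> measure_pmf.expectation M \<Phi> / t"
proof -
  have "t * measure_pmf.prob M E = measure_pmf.expectation M (\<lambda>\<omega>. t * indicator E \<omega>)"
    by simp
  also have "\<dots> \<le> measure_pmf.expectation M \<Phi>"
    by (intro integral_mono integrable_measure_pmf_finite) (auto simp: indicator_def nn ge)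
  finally show ?thesis using t by (simp add: field_simps)
qed

section \<open>Powers of positive semidefinite operators\<close>

text \<open>The ratios of consecutive terms of a log-convex sequence increase. Clearing denominators
  admits zeros: a zero term forces the next one to vanish, so the left side is then 0.\<close>

lemma log_convex_ratio_mono:
  fixes g :: "nat \<Rightarrow> real"
  assumes nn: "\<And>m. 0 \<le> g m" and lc: "\<And>m. (g (Suc m))\<^sup>2 \<le> g m * g (Suc (Suc m))"
  shows "g (Suc i) * g (i + d) \<le> g i * g (Suc (i + d))"
proof (induction d)
  case 0
  show ?case by simp
next
  case (Suc d)
  let ?m = "i + d"
  show ?case
  proof (cases "g ?m = 0")
    case True
    then have "(g (Suc ?m))\<^sup>2 \<le> 0"
      using lc[of ?m] by simp
    then show ?thesis
      using nn[of i] nn[of "Suc (Suc ?m)"] by simp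
  next
    case False
    then have pos: "0 < g ?m"
      using nn[of ?m] by simp
    have "g ?m * (g (Suc i) * g (Suc ?m)) = (g (Suc i) * g ?m) * g (Suc ?m)"
      by simp
    also have "\<dots> \<le> (g i * g (Suc ?m)) * g (Suc ?m)"
      using Suc.IH nn by (intro mult_right_mono) auto
    also have "\<dots> = g i * (g (Suc ?m))\<^sup>2"
      by (simp add: power2_eq_square)
    also have "\<dots> \<le> g i * (g ?m * g (Suc (Suc ?m)))"
      using lc nn by (intro mult_left_mono) auto
    also have "\<dots> = g ?m * (g i * g (Suc (Suc ?m)))"
      by simp
    finally show ?thesis
      using pos by simp
  qed
qed

text \<open>Lowering the smaller index by one and raising the larger by one does not decrease the
  product, by monotonicity of the ratios. Repeating this moves the smaller index to 0, whence the
  induction on it with the larger one arbitrary.\<close>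

lemma log_convex_supermult:
  fixes g :: "nat \<Rightarrow> real"
  assumes nn: "\<And>m. 0 \<le> g m" and lc: "\<And>m. (g (Suc m))\<^sup>2 \<le> g m * g (Suc (Suc m))"
  shows "g i * g j \<le> g 0 * g (i + j)"
proof -
  have *: "g i * g j \<le> g 0 * g (i + j)" if "i \<le> j" for i j
    using that
  proof (induction i arbitrary: j)
    case (Suc i)
    have "g (Suc i) * g j \<le> g i * g (Suc j)"
      using log_convex_ratio_mono[of g i "j - i", OF nn lc] Suc.prems by simp
    also have "\<dots> \<le> g 0 * g (i + Suc j)"
      using Suc.IH[of "Suc j"] Suc.prems by simp
    finally show ?case by simp
  qed simp
  show ?thesis
    using *[of i j] *[of j i] by (cases "i \<le> j") (auto simp: mult.commute add.commute)
qed

lemma nat_parity_cases: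
  fixes m :: nat
  obtains (even) c where "m = c + c" | (odd) c where "m = Suc (c + c)"
  by (metis evenE oddE mult_2 Suc_eq_plus1)

section \<open>Moments of a positive semidefinite operator\<close>

locale psd_operator =
  fixes B :: "'a::real_inner \<Rightarrow> 'a"
  assumes linear: "linear B"
    and sym: "B x \<bullet> y = x \<bullet> B y"
    and nonneg: "0 \<le> x \<bullet> B x"
begin

lemma linear_funpow: "linear (B ^^ m)"
  by (induction m) (simp_all only: funpow.simps linear_id linear_compose linear)

lemma funpow_sym: "(B ^^ m) x \<bullet> y = x \<bullet> (B ^^ m) y"
  by (induction m arbitrary: x y) (auto simp: sym funpow_swap1)

lemma inner_funpow: "(B ^^ i) x \<bullet> (B ^^ j) y = x \<bullet> (B ^^ (i + j)) y"
  by (simp add: funpow_sym funpow_add)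

lemma cauchy_schwarz: "(x \<bullet> B y)\<^sup>2 \<le> (x \<bullet> B x) * (y \<bullet> B y)"
proof -
  have q: "0 \<le> x \<bullet> B x + 2 * t * (x \<bullet> B y) + t\<^sup>2 * (y \<bullet> B y)" for t
  proof -
    have "y \<bullet> B x = x \<bullet> B y"
      by (metis inner_commute sym)
    then show ?thesis
      using nonneg[of "x + t *\<^sub>R y"]
      by (simp add: linear_add[OF linear] linear_scale[OF linear] algebra_simps power2_eq_square)
  qed
  show ?thesis
  proof (cases "y \<bullet> B y = 0")
    case True
    have "x \<bullet> B y = 0"
    proof (rule ccontr)
      assume ne: "x \<bullet> B y \<noteq> 0"
      \<comment> \<open>The quadratic in \<open>t\<close> is affine here with nonzero slope, and the
        chosen \<open>t\<close> gives it the value -1.\<close>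
      show False
        using q[of "- (x \<bullet> B x + 1) / (2 * (x \<bullet> B y))"] ne True by (simp add: field_simps)
    qed
    then show ?thesis by (simp add: True)
  next
    case False
    then have "0 < y \<bullet> B y"
      using nonneg[of y] by simp
    then show ?thesis
      using q[of "- (x \<bullet> B y) / (y \<bullet> B y)"] by (simp add: field_simps power2_eq_square)
  qed
qed

text \<open>For a diagonalisable \<open>B\<close> these are the moments of the spectral measure of
  \<open>B\<close> at \<open>w\<close>, a measure on the nonnegative reals. The usual moment
  inequalities are derived below without a spectral decomposition.\<close>

definition moment :: "'a \<Rightarrow> nat \<Rightarrow> real" where
  "moment w m = w \<bullet> (B ^^ m) w"

lemma moment_even: "moment w (c + c) = (norm ((B ^^ c) w))\<^sup>2"
  by (simp add: moment_def inner_funpow[symmetric] dot_square_norm)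

lemma moment_odd: "moment w (Suc (c + c)) = (B ^^ c) w \<bullet> B ((B ^^ c) w)"
  using inner_funpow[of c w "Suc c" w] by (simp add: moment_def)

lemma moment_nonneg: "0 \<le> moment w m"
  by (rule nat_parity_cases[of m]) (simp_all only: moment_even moment_odd nonneg zero_le_power2)

text \<open>With \<open>u = (B ^^ c) w\<close>, the even case is Cauchy-Schwarz for \<open>u\<close>
  and \<open>B u\<close> in the inner product, the odd case the same for the form
  \<open>x \<bullet> B y\<close>. Splitting by parity avoids a square root of
  \<open>B\<close>.\<close>

lemma moment_log_convex: "(moment w (Suc m))\<^sup>2 \<le> moment w m * moment w (Suc (Suc m))"
proof (rule nat_parity_cases[of m])
  fix c assume m: "m = c + c"
  have *: "moment w (Suc (Suc m)) = (norm (B ((B ^^ c) w)))\<^sup>2"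
    using moment_even[of w "Suc c"] by (simp add: m)
  show ?thesis
    unfolding * unfolding m moment_even moment_odd
    using Cauchy_Schwarz_ineq[of "(B ^^ c) w" "B ((B ^^ c) w)"] by (simp add: dot_square_norm)
next
  fix c assume m: "m = Suc (c + c)"
  let ?u = "(B ^^ c) w"
  have 1: "moment w (Suc m) = ?u \<bullet> B (B ?u)"
    using inner_funpow[of c w "Suc (Suc c)" w] by (simp add: m moment_def)
  have 2: "moment w (Suc (Suc m)) = B ?u \<bullet> B (B ?u)"
    using inner_funpow[of "Suc c" w "Suc (Suc c)" w] by (simp add: m moment_def)
  show ?thesis
    unfolding 1 2 unfolding m moment_odd by (rule cauchy_schwarz)
qed

lemma moment_supermult: "moment w i * moment w j \<le> (norm w)\<^sup>2 * moment w (i + j)"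
  using log_convex_supermult[of "moment w", OF moment_nonneg moment_log_convex]
  by (simp add: moment_def dot_square_norm)

text \<open>Jensen's inequality for the spectral measure, obtained by splitting off one factor at a
  time with \<open>moment_supermult\<close>.\<close>

lemma moment_power_le:
  assumes "norm w = 1"
  shows "(w \<bullet> B w) ^ m \<le> moment w m"
proof (induction m)
  case 0
  then show ?case using assms by (simp add: moment_def dot_square_norm)
next
  case (Suc m)
  have "(w \<bullet> B w) ^ Suc m \<le> moment w 1 * moment w m"
    using mult_left_mono[OF Suc nonneg[of w]] by (simp add: moment_def)
  also have "\<dots> \<le> moment w (Suc m)"
    using moment_supermult[of w 1 m] assms by simp
  finally show ?case .
qed

text \<open>The ratio of consecutive moments is smallest at the start, where it is the Rayleigh
  quotient of \<open>w\<close>; a bound at this one vector therefore suffices.\<close>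

lemma moment_Suc_ge:
  assumes "\<beta> * (norm w)\<^sup>2 \<le> w \<bullet> B w"
  shows "\<beta> * moment w m \<le> moment w (Suc m)"
proof (cases "w = 0")
  case True
  then show ?thesis by (simp add: moment_def)
next
  case False
  then have pos: "0 < (norm w)\<^sup>2" by simp
  have "(norm w)\<^sup>2 * (\<beta> * moment w m) \<le> moment w 1 * moment w m"
    using mult_right_mono[OF assms moment_nonneg[of w m]] by (simp add: moment_def mult_ac)
  also have "\<dots> \<le> (norm w)\<^sup>2 * moment w (Suc m)"
    using moment_supermult[of w 1 m] by simp
  finally show ?thesis using pos by simp
qed

lemma moment_Suc_le:
  assumes le: "\<And>x. x \<bullet> B x \<le> (norm x)\<^sup>2"
  shows "moment w (Suc m) \<le> moment w m"
proof (rule nat_parity_cases[of m])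
  fix c assume m: "m = c + c"
  show ?thesis unfolding m moment_odd moment_even by (rule le)
next
  fix c assume m: "m = Suc (c + c)"
  \<comment> \<open>The hypothesis at \<open>(B ^^ Suc c) w\<close> controls the next ratio of
    moments. Since the ratios increase, the present one is at most 1 as well.\<close>
  have ev: "moment w (Suc (Suc m)) \<le> moment w (Suc m)"
    using le[of "(B ^^ Suc c) w"] moment_odd[of w "Suc c"] moment_even[of w "Suc c"] by (simp add: m)
  have "(moment w (Suc m))\<^sup>2 \<le> moment w m * moment w (Suc m)"
    using moment_log_convex[of w m] mult_left_mono[OF ev moment_nonneg[of w m]] by linarith
  then show ?thesis
    using moment_nonneg[of w m] moment_nonneg[of w "Suc m"]
    by (cases "moment w (Suc m) = 0") (simp_all add: power2_eq_square)
qed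

end

text \<open>Discrete Duhamel formula: for \<open>B' = B - a w w^T\<close>, the difference of the
  m-th powers telescopes into terms \<open>B^(m-1-j) (a w w^T) B'^j\<close>. Keeping
  \<open>B'\<close> on the right leaves scalar coefficients that are themselves moments of
  \<open>B'\<close> when \<open>x = w\<close>.\<close>

lemma rank_one_funpow:
  fixes B :: "'a::real_inner \<Rightarrow> 'a"
  assumes "linear B"
  shows "((\<lambda>x. B x - (a * (w \<bullet> x)) *\<^sub>R w) ^^ m) x =
    (B ^^ m) x - (\<Sum>j<m. (a * (w \<bullet> ((\<lambda>x. B x - (a * (w \<bullet> x)) *\<^sub>R w) ^^ j) x)) *\<^sub>R (B ^^ (m - 1 - j)) w)"
proof (induction m)
  case (Suc m)
  let ?B' = "\<lambda>x. B x - (a * (w \<bullet> x)) *\<^sub>R w"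
  have "(?B' ^^ Suc m) x = B ((?B' ^^ m) x) - (a * (w \<bullet> (?B' ^^ m) x)) *\<^sub>R w"
    by simp
  also have "B ((?B' ^^ m) x) = (B ^^ Suc m) x
      - (\<Sum>j<m. (a * (w \<bullet> (?B' ^^ j) x)) *\<^sub>R B ((B ^^ (m - 1 - j)) w))"
    by (subst Suc.IH) (simp add: linear_diff[OF assms] linear_sum[OF assms] linear_scale[OF assms])
  also have "(\<Sum>j<m. (a * (w \<bullet> (?B' ^^ j) x)) *\<^sub>R B ((B ^^ (m - 1 - j)) w))
      = (\<Sum>j<m. (a * (w \<bullet> (?B' ^^ j) x)) *\<^sub>R (B ^^ (Suc m - 1 - j)) w)"
  proof (rule sum.cong)
    fix j assume "j \<in> {..<m}"
    then have "Suc m - 1 - j = Suc (m - 1 - j)" by auto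
    then show "(a * (w \<bullet> (?B' ^^ j) x)) *\<^sub>R B ((B ^^ (m - 1 - j)) w)
        = (a * (w \<bullet> (?B' ^^ j) x)) *\<^sub>R (B ^^ (Suc m - 1 - j)) w" by simp
  qed simp
  finally show ?case by simp
qed simp

text \<open>This takes the place of the Golden--Thompson inequality in the proof of the matrix Chernoff bound.\<close>

lemma trace_rank_one_update:
  fixes B B' :: "'a::real_inner \<Rightarrow> 'a"
  assumes B: "psd_operator B" and B': "psd_operator B'"
    and B'_def: "B' = (\<lambda>x. B x - (a * (w \<bullet> x)) *\<^sub>R w)" and a: "0 \<le> a"
    and parseval: "\<And>i j. (\<Sum>p\<in>K. ((B' ^^ i) w \<bullet> e p) * (e p \<bullet> (B ^^ j) w)) = (B' ^^ i) w \<bullet> (B ^^ j) w"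
  shows "(\<Sum>p\<in>K. e p \<bullet> (B' ^^ (m + 2)) (e p)) \<le> (\<Sum>p\<in>K. e p \<bullet> (B ^^ (m + 2)) (e p))
     - a * real (m + 2) * psd_operator.moment B w (Suc m)
     + a\<^sup>2 * (real (m + 2) * real (m + 1) / 2) * (norm w)\<^sup>2 * psd_operator.moment B w m"
proof -
  interpret B: psd_operator B by fact
  interpret B': psd_operator B' by fact
  let ?g = "B.moment w" and ?G = "B'.moment w"
  have pw: "(B' ^^ n) x = (B ^^ n) x - (\<Sum>j<n. (a * (w \<bullet> (B' ^^ j) x)) *\<^sub>R (B ^^ (n - 1 - j)) w)" for n x
    unfolding B'_def by (rule rank_one_funpow) (rule B.linear)
  have G_le: "?G n \<le> ?g n" for n
  proof -
    have "?G n = ?g n - (\<Sum>j<n. a * ?G j * ?g (n - 1 - j))"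
      unfolding B'.moment_def B.moment_def by (subst pw) (simp add: inner_diff_right inner_sum_right)
    moreover have "0 \<le> (\<Sum>j<n. a * ?G j * ?g (n - 1 - j))"
      using a B'.moment_nonneg B.moment_nonneg by (intro sum_nonneg mult_nonneg_nonneg) auto
    ultimately show ?thesis by simp
  qed
  \<comment> \<open>Trading the \<open>i\<close> factors \<open>B'\<close> for \<open>B\<close>
    costs \<open>i\<close> terms, each a product \<open>?G j * ?g (m - j)\<close>. Replacing
    \<open>?G j\<close> by the larger \<open>?g j\<close> and applying supermultiplicativity bounds
    it by \<open>(norm w)\<^sup>2 * ?g m\<close>.\<close>
  have mixed: "?g (Suc m) - a * real i * ((norm w)\<^sup>2 * ?g m) \<le> (B' ^^ i) w \<bullet> (B ^^ (Suc m - i)) w"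
    if "i \<le> Suc m" for i
  proof -
    have eq: "(B' ^^ i) w \<bullet> (B ^^ (Suc m - i)) w
        = ?g (Suc m) - (\<Sum>j<i. a * ?G j * ((B ^^ (i - 1 - j)) w \<bullet> (B ^^ (Suc m - i)) w))"
      unfolding B'.moment_def B.moment_def using that
      by (subst pw) (simp add: inner_diff_left inner_sum_left B.inner_funpow)
    have "(\<Sum>j<i. a * ?G j * ((B ^^ (i - 1 - j)) w \<bullet> (B ^^ (Suc m - i)) w))
        = (\<Sum>j<i. a * (?G j * ?g (m - j)))"
      using that by (intro sum.cong) (auto simp: B.inner_funpow B.moment_def)
    also have "\<dots> \<le> (\<Sum>j<i. a * ((norm w)\<^sup>2 * ?g m))"
    proof (intro sum_mono mult_left_mono a)
      fix j assume "j \<in> {..<i}"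
      then have j: "j \<le> m" using that by simp
      have "?G j * ?g (m - j) \<le> ?g j * ?g (m - j)"
        using G_le B.moment_nonneg by (intro mult_right_mono) auto
      also have "\<dots> \<le> (norm w)\<^sup>2 * ?g m"
        using B.moment_supermult[of w j "m - j"] j by simp
      finally show "?G j * ?g (m - j) \<le> (norm w)\<^sup>2 * ?g m" .
    qed
    finally show ?thesis unfolding eq by (simp add: mult_ac)
  qed
  \<comment> \<open>Summing the telescoping formula over the family turns every term into a mixed
    moment of total order \<open>m + 1\<close>. The exponent \<open>m + 2\<close> is chosen so that
    the first- and second-order corrections have the orders \<open>m + 1\<close> and
    \<open>m\<close>.\<close>
  have "(\<Sum>p\<in>K. e p \<bullet> (B' ^^ (m + 2)) (e p)) = (\<Sum>p\<in>K. e p \<bullet> (B ^^ (m + 2)) (e p))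
      - (\<Sum>p\<in>K. \<Sum>j<m+2. a * (((B' ^^ j) w \<bullet> e p) * (e p \<bullet> (B ^^ (Suc m - j)) w)))"
    by (subst pw) (simp add: inner_diff_right inner_sum_right sum_subtractf B'.funpow_sym[symmetric] mult.assoc
         del: funpow.simps sum.lessThan_Suc)
  also have "(\<Sum>p\<in>K. \<Sum>j<m+2. a * (((B' ^^ j) w \<bullet> e p) * (e p \<bullet> (B ^^ (Suc m - j)) w)))
      = (\<Sum>j<m+2. a * ((B' ^^ j) w \<bullet> (B ^^ (Suc m - j)) w))"
    by (subst sum.swap) (simp only: sum_distrib_left[symmetric] parseval)
  finally have tr: "(\<Sum>p\<in>K. e p \<bullet> (B' ^^ (m + 2)) (e p)) = (\<Sum>p\<in>K. e p \<bullet> (B ^^ (m + 2)) (e p))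
      - (\<Sum>j<m+2. a * ((B' ^^ j) w \<bullet> (B ^^ (Suc m - j)) w))" .
  have "(\<Sum>j<m+2. a * (?g (Suc m) - a * real j * ((norm w)\<^sup>2 * ?g m)))
      \<le> (\<Sum>j<m+2. a * ((B' ^^ j) w \<bullet> (B ^^ (Suc m - j)) w))"
    using a mixed by (intro sum_mono mult_left_mono) auto
  moreover have "(\<Sum>j<m+2. a * (?g (Suc m) - a * real j * ((norm w)\<^sup>2 * ?g m)))
      = a * real (m + 2) * ?g (Suc m) - a\<^sup>2 * (\<Sum>j<m+2. real j) * ((norm w)\<^sup>2 * ?g m)"
  proof -
    have "(\<Sum>j<m+2. a * (?g (Suc m) - a * real j * ((norm w)\<^sup>2 * ?g m)))
      = (\<Sum>j<m+2. a * ?g (Suc m) - (a\<^sup>2 * ((norm w)\<^sup>2 * ?g m)) * real j)"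
      by (intro sum.cong) (auto simp: algebra_simps power2_eq_square)
    also have "\<dots> = real (m + 2) * (a * ?g (Suc m)) - (a\<^sup>2 * ((norm w)\<^sup>2 * ?g m)) * (\<Sum>j<m+2. real j)"
      by (simp only: sum_subtractf sum_distrib_left) simp
    finally show ?thesis by (simp add: algebra_simps)
  qed
  ultimately have "a * real (m + 2) * ?g (Suc m) - a\<^sup>2 * (\<Sum>j<m+2. real j) * ((norm w)\<^sup>2 * ?g m)
      \<le> (\<Sum>j<m+2. a * ((B' ^^ j) w \<bullet> (B ^^ (Suc m - j)) w))"
    by (simp only:)
  moreover have "(\<Sum>j<m+2. real j) = real (m + 2) * real (m + 1) / 2"
    by (induction m) (simp_all add: field_simps)
  ultimately show ?thesis
    unfolding tr by (simp only: mult.assoc)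
qed

section \<open>A matrix Chernoff bound\<close>

text \<open>The assumption \<open>isotropic\<close> says that the sum of \<open>u u^T\<close> over
  \<open>l\<close> independent draws has the projection \<open>P\<close> as its mean. The Chernoff
  bound then measures how far this sum can fall below \<open>P\<close>.\<close>

locale rank_one_sampling = orthonormal_family V K
  for V :: "'i \<Rightarrow> 'a::real_inner" and K :: "'i set" +
  fixes q :: "'b::finite pmf" and u :: "'b \<Rightarrow> 'a" and l :: nat and R :: real
  assumes u_proj: "P (u i) = u i"
    and norm_u: "(norm (u i))\<^sup>2 \<le> R" and R_pos: "0 < R"
    and isotropic: "\<lbrakk>p \<in> K; p' \<in> K\<rbrakk> \<Longrightarrow>
      real l * (\<Sum>i\<in>UNIV. pmf q i * ((V p \<bullet> u i) * (V p' \<bullet> u i))) = (if p = p' then 1 else 0)"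
begin

text \<open>The mean of \<open>u u^T\<close> over one draw is \<open>P / l\<close>, so averaging a
  quadratic form yields a trace. This closes the recursion for the potential.\<close>

lemma expectation_quadratic:
  assumes Z: "linear Z"
  shows "real l * (\<Sum>i\<in>UNIV. pmf q i * (u i \<bullet> Z (u i))) = (\<Sum>p\<in>K. V p \<bullet> Z (V p))"
proof -
  have quad: "u i \<bullet> Z (u i) = (\<Sum>p\<in>K. \<Sum>p'\<in>K. ((V p \<bullet> u i) * (V p' \<bullet> u i)) * (V p \<bullet> Z (V p')))" for i
  proof -
    have u: "u i = (\<Sum>p\<in>K. (V p \<bullet> u i) *\<^sub>R V p)"
      using u_proj[of i] by (simp add: ortho_proj_def)
    have "u i \<bullet> Z (u i) = (\<Sum>p\<in>K. (V p \<bullet> u i) *\<^sub>R V p) \<bullet> Z (\<Sum>p\<in>K. (V p \<bullet> u i) *\<^sub>R V p)"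
      using u by simp
    also have "\<dots> = (\<Sum>p\<in>K. \<Sum>p'\<in>K. ((V p \<bullet> u i) * (V p' \<bullet> u i)) * (V p \<bullet> Z (V p')))"
      by (simp add: linear_sum[OF Z] linear_scale[OF Z] inner_sum_left inner_sum_right sum_distrib_left)
        (subst sum.swap, simp add: mult_ac)
    finally show ?thesis .
  qed
  have "real l * (\<Sum>i\<in>UNIV. pmf q i * (u i \<bullet> Z (u i)))
      = (\<Sum>i\<in>UNIV. \<Sum>p\<in>K. \<Sum>p'\<in>K. (V p \<bullet> Z (V p')) * (real l * (pmf q i * ((V p \<bullet> u i) * (V p' \<bullet> u i)))))"
    unfolding quad by (simp add: sum_distrib_left mult_ac)
  also have "\<dots> = (\<Sum>p\<in>K. \<Sum>p'\<in>K. (V p \<bullet> Z (V p')) *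
      (real l * (\<Sum>i\<in>UNIV. pmf q i * ((V p \<bullet> u i) * (V p' \<bullet> u i)))))"
    by (subst sum.swap, rule sum.cong[OF refl], subst sum.swap) (simp add: sum_distrib_left)
  also have "\<dots> = (\<Sum>p\<in>K. \<Sum>p'\<in>K. if p = p' then V p \<bullet> Z (V p') else 0)"
    by (intro sum.cong refl) (simp add: isotropic)
  also have "\<dots> = (\<Sum>p\<in>K. V p \<bullet> Z (V p))"
    by (simp add: finite)
  finally show ?thesis .
qed

text \<open>The operator \<open>1 - a S\<close>, where \<open>S\<close> is the sum of
  \<open>u u^T\<close> over the draws at the positions in \<open>J\<close>. With
  \<open>a = \<theta> / n\<close> its n-th power approximates
  \<open>exp (- \<theta> S)\<close>.\<close>

definition shrink :: "real \<Rightarrow> 'j set \<Rightarrow> ('j \<Rightarrow> 'b) \<Rightarrow> 'a \<Rightarrow> 'a" where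
  "shrink a J \<omega> x = x - (\<Sum>j\<in>J. (a * (u (\<omega> j) \<bullet> x)) *\<^sub>R u (\<omega> j))"

lemma inner_shrink: "y \<bullet> shrink a J \<omega> x = y \<bullet> x - a * (\<Sum>j\<in>J. (u (\<omega> j) \<bullet> x) * (u (\<omega> j) \<bullet> y))"
  by (simp add: shrink_def inner_diff_right inner_sum_right sum_distrib_left mult_ac inner_commute)

lemma shrink_insert:
  assumes "finite J" "j \<notin> J"
  shows "shrink a (insert j J) (fun_upd \<omega> j i) = (\<lambda>x. shrink a J \<omega> x - (a * (u i \<bullet> x)) *\<^sub>R u i)"
proof
  fix x
  have "(\<Sum>j'\<in>J. (a * (u (fun_upd \<omega> j i j') \<bullet> x)) *\<^sub>R u (fun_upd \<omega> j i j')) = (\<Sum>j\<in>J. (a * (u (\<omega> j) \<bullet> x)) *\<^sub>R u (\<omega> j))"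
    using assms(2) by (intro sum.cong) auto
  then show "shrink a (insert j J) (fun_upd \<omega> j i) x = shrink a J \<omega> x - (a * (u i \<bullet> x)) *\<^sub>R u i"
    using assms by (simp add: shrink_def)
qed

lemma shrink_upper: "0 \<le> a \<Longrightarrow> x \<bullet> shrink a J \<omega> x \<le> (norm x)\<^sup>2"
  unfolding inner_shrink by (simp add: dot_square_norm sum_nonneg)

text \<open>A crude bound: each of the at most \<open>l\<close> draws lowers the form by at most
  \<open>a * R\<close>. It is good enough because \<open>a\<close> tends to 0 while \<open>l\<close>
  and \<open>R\<close> stay fixed.\<close>

lemma shrink_lower:
  assumes a: "0 \<le> a" and J: "card J \<le> l"
  shows "(1 - a * (real l * R)) * (norm x)\<^sup>2 \<le> x \<bullet> shrink a J \<omega> x"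
proof -
  have "(\<Sum>j\<in>J. (u (\<omega> j) \<bullet> x) * (u (\<omega> j) \<bullet> x)) \<le> real (card J) * (R * (norm x)\<^sup>2)"
  proof (rule sum_bounded_above)
    fix j
    have "(u (\<omega> j) \<bullet> x) * (u (\<omega> j) \<bullet> x) \<le> (norm (u (\<omega> j)))\<^sup>2 * (norm x)\<^sup>2"
      using Cauchy_Schwarz_ineq[of "u (\<omega> j)" x] by (simp add: dot_square_norm power2_eq_square)
    also have "\<dots> \<le> R * (norm x)\<^sup>2"
      by (intro mult_right_mono norm_u) auto
    finally show "(u (\<omega> j) \<bullet> x) * (u (\<omega> j) \<bullet> x) \<le> R * (norm x)\<^sup>2" .
  qed
  also have "\<dots> \<le> real l * (R * (norm x)\<^sup>2)"
    using J R_pos by (intro mult_right_mono) auto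
  finally have "a * (\<Sum>j\<in>J. (u (\<omega> j) \<bullet> x) * (u (\<omega> j) \<bullet> x)) \<le> a * (real l * (R * (norm x)\<^sup>2))"
    using a by (intro mult_left_mono)
  then show ?thesis
    unfolding inner_shrink by (simp add: dot_square_norm algebra_simps)
qed

lemma psd_shrink:
  assumes a: "0 \<le> a" and J: "card J \<le> l" and small: "a * (real l * R) \<le> 1"
  shows "psd_operator (shrink a J \<omega>)"
proof (rule psd_operator.intro)
  show "linear (shrink a J \<omega>)"
    unfolding shrink_def
    by (intro linearI) (simp_all add: inner_add_right algebra_simps sum.distrib scaleR_sum_right)
  show "shrink a J \<omega> x \<bullet> y = x \<bullet> shrink a J \<omega> y" for x y
    by (subst inner_commute) (simp add: inner_shrink inner_commute mult.commute)
  have "0 \<le> (1 - a * (real l * R)) * (norm x)\<^sup>2" for x :: 'a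
    using small by simp
  then show "0 \<le> x \<bullet> shrink a J \<omega> x" for x
    using shrink_lower[OF a J, of x \<omega>] order_trans by blast
qed

lemma proj_shrink_funpow: "P x = x \<Longrightarrow> P ((shrink a J \<omega> ^^ m) x) = (shrink a J \<omega> ^^ m) x"
proof (induction m)
  case (Suc m)
  then show ?case
    by (simp add: shrink_def linear_diff[OF linear_proj] linear_sum[OF linear_proj]
        linear_scale[OF linear_proj] u_proj)
qed simp

definition potential :: "real \<Rightarrow> nat \<Rightarrow> 'j set \<Rightarrow> ('j \<Rightarrow> 'b) \<Rightarrow> real" where
  "potential a n J \<omega> = (\<Sum>p\<in>K. V p \<bullet> (shrink a J \<omega> ^^ n) (V p))"

text \<open>Put \<open>\<theta> = a (m + 2)\<close>. On average the first-order part of the rank-one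
  update removes a fraction \<open>\<theta> / l\<close> of the potential, and the second-order part
  gives back at most the share \<open>1 / (4 \<beta>)\<close> of what the first-order part
  removes.\<close>

lemma potential_step:
  assumes a: "0 \<le> a" and \<beta>: "\<beta> = 1 - a * (real l * R)" "0 < \<beta>" "1 \<le> 4 * \<beta>"
    and aN: "a * real (m + 2) * R = 1 / 2"
    and J: "finite J" "j \<notin> J" "card (insert j J) \<le> l" and l: "0 < l"
  shows "measure_pmf.expectation q (\<lambda>i. potential a (m + 2) (insert j J) (fun_upd \<omega> j i))
    \<le> exp (- (a * real (m + 2) * (1 - 1 / (4 * \<beta>)) / real l)) * potential a (m + 2) J \<omega>"
proof -
  have Jl: "card J \<le> l" using J by simp
  have small: "a * (real l * R) \<le> 1" using \<beta> by simp
  interpret B: psd_operator "shrink a J \<omega>" by (rule psd_shrink[OF a Jl small])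
  let ?B = "shrink a J \<omega>" and ?\<theta> = "a * real (m + 2)"
  define \<eta> where "\<eta> = 1 - 1 / (4 * \<beta>)"
  have \<eta>: "0 \<le> \<eta>" using \<beta> by (simp add: \<eta>_def field_simps)
  have pointwise: "potential a (m + 2) (insert j J) (fun_upd \<omega> j i)
      \<le> potential a (m + 2) J \<omega> - ?\<theta> * \<eta> * B.moment (u i) (Suc m)" for i
  proof -
    let ?w = "u i" and ?B' = "shrink a (insert j J) (fun_upd \<omega> j i)"
    have "potential a (m + 2) (insert j J) (fun_upd \<omega> j i) \<le> potential a (m + 2) J \<omega>
       - a * real (m + 2) * B.moment ?w (Suc m)
       + a\<^sup>2 * (real (m + 2) * real (m + 1) / 2) * (norm ?w)\<^sup>2 * B.moment ?w m"
      unfolding potential_def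
    proof (rule trace_rank_one_update[OF B.psd_operator_axioms])
      show "psd_operator ?B'"
        by (rule psd_shrink[OF a J(3) small])
      show "?B' = (\<lambda>x. ?B x - (a * (?w \<bullet> x)) *\<^sub>R ?w)"
        using J by (intro shrink_insert) auto
      show "(\<Sum>p\<in>K. ((?B' ^^ i') ?w \<bullet> V p) * (V p \<bullet> (?B ^^ j') ?w)) = (?B' ^^ i') ?w \<bullet> (?B ^^ j') ?w" for i' j'
        by (intro parseval proj_shrink_funpow u_proj)
    qed (rule a)
    \<comment> \<open>The condition \<open>aN\<close> caps one factor at 1/2, and the lower bound on
      the operator trades the moment of order \<open>m\<close> for that of order
      \<open>m + 1\<close> at the price \<open>1 / \<beta>\<close>, so that it can be absorbed into
      the first-order term.\<close>
    moreover have "a\<^sup>2 * (real (m + 2) * real (m + 1) / 2) * (norm ?w)\<^sup>2 * B.moment ?w m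
        \<le> ?\<theta> / (4 * \<beta>) * B.moment ?w (Suc m)"
    proof -
      have low: "\<beta> * B.moment ?w m \<le> B.moment ?w (Suc m)"
        unfolding \<beta>(1) by (rule B.moment_Suc_ge[OF shrink_lower[OF a Jl]])
      have "a * real (m + 1) * (norm ?w)\<^sup>2 \<le> a * real (m + 2) * R"
        using a norm_u[of i] R_pos by (intro mult_mono) auto
      then have aw: "a * real (m + 1) * (norm ?w)\<^sup>2 \<le> 1 / 2"
        unfolding aN .
      have "a\<^sup>2 * (real (m + 2) * real (m + 1) / 2) * (norm ?w)\<^sup>2 * B.moment ?w m
          = ?\<theta> / 2 * (a * real (m + 1) * (norm ?w)\<^sup>2) * B.moment ?w m"
        by (simp add: power2_eq_square)
      also have "\<dots> \<le> ?\<theta> / 2 * (1 / 2) * B.moment ?w m"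
        using a aw B.moment_nonneg by (intro mult_right_mono mult_left_mono) auto
      also have "\<dots> = ?\<theta> / (4 * \<beta>) * (\<beta> * B.moment ?w m)"
        using \<beta>(2) by simp
      also have "\<dots> \<le> ?\<theta> / (4 * \<beta>) * B.moment ?w (Suc m)"
        using a \<beta> low by (intro mult_left_mono) auto
      finally show ?thesis .
    qed
    moreover have "?\<theta> * \<eta> * B.moment ?w (Suc m) = ?\<theta> * B.moment ?w (Suc m) - ?\<theta> / (4 * \<beta>) * B.moment ?w (Suc m)"
      by (simp only: \<eta>_def right_diff_distrib left_diff_distrib mult_1_right times_divide_eq_right)
    ultimately show ?thesis by linarith
  qed
  have pot: "0 \<le> potential a (m + 2) J \<omega>"
    unfolding potential_def B.moment_def[symmetric] by (intro sum_nonneg B.moment_nonneg)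
  \<comment> \<open>The operator is at most 1, so lowering the power by one only increases the
    trace; by isotropy that trace is \<open>l\<close> times the mean of the moment at a random
    \<open>u i\<close>.\<close>
  have "potential a (m + 2) J \<omega> \<le> (\<Sum>p\<in>K. B.moment (V p) (Suc m))"
    unfolding potential_def using B.moment_Suc_le[OF shrink_upper[OF a], of _ "Suc m"]
    by (intro sum_mono) (simp add: B.moment_def)
  also have "\<dots> = real l * (\<Sum>i\<in>UNIV. pmf q i * B.moment (u i) (Suc m))"
    unfolding B.moment_def using expectation_quadratic[OF B.linear_funpow[of "Suc m"]] by simp
  finally have mean: "potential a (m + 2) J \<omega> / real l \<le> (\<Sum>i\<in>UNIV. pmf q i * B.moment (u i) (Suc m))"
    using l by (simp add: field_simps)
  have "measure_pmf.expectation q (\<lambda>i. potential a (m + 2) (insert j J) (fun_upd \<omega> j i))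
      \<le> (\<Sum>i\<in>UNIV. pmf q i * (potential a (m + 2) J \<omega> - ?\<theta> * \<eta> * B.moment (u i) (Suc m)))"
    unfolding expectation_finite_pmf by (intro sum_mono mult_left_mono pointwise) auto
  also have "\<dots> = (\<Sum>i\<in>UNIV. pmf q i) * potential a (m + 2) J \<omega>
      - ?\<theta> * \<eta> * (\<Sum>i\<in>UNIV. pmf q i * B.moment (u i) (Suc m))"
    by (simp only: sum_distrib_left sum_distrib_right sum_subtractf[symmetric])
      (intro sum.cong, simp_all add: algebra_simps)
  also have "\<dots> \<le> potential a (m + 2) J \<omega> - ?\<theta> * \<eta> * (potential a (m + 2) J \<omega> / real l)"
    using mult_left_mono[OF mean, of "?\<theta> * \<eta>"] a \<eta> by (simp add: sum_pmf_eq_1)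
  also have "\<dots> = (1 + - (?\<theta> * \<eta> / real l)) * potential a (m + 2) J \<omega>"
    by (simp only: distrib_right mult_1_left minus_mult_left[symmetric] times_divide_eq_left
        times_divide_eq_right diff_conv_add_uminus)
  also have "\<dots> \<le> exp (- (?\<theta> * \<eta> / real l)) * potential a (m + 2) J \<omega>"
    by (intro mult_right_mono exp_ge_add_one_self pot)
  finally show ?thesis by (simp add: \<eta>_def)
qed

text \<open>A bad direction \<open>x\<close> has Rayleigh quotient at least
  \<open>1 - a / 2\<close>, and Jensen's inequality raises this to the power \<open>n\<close>. For
  even \<open>n\<close> the moment is the squared norm of half the power at \<open>x\<close>, hence
  at most the trace. A bound on the trace thus covers all directions at once.\<close>

lemma potential_lower:
  assumes a: "0 \<le> a" and J: "card J \<le> l" and small: "a * (real l * R) \<le> 1"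
    and x: "P x = x" "norm x = 1" and n: "even n"
    and small_form: "(\<Sum>j\<in>J. (u (\<omega> j) \<bullet> x)\<^sup>2) < 1 / 2" and a2: "a \<le> 2"
  shows "(1 - a / 2) ^ n \<le> potential a n J \<omega>"
proof -
  interpret B: psd_operator "shrink a J \<omega>" by (rule psd_shrink[OF a J small])
  obtain c where c: "n = c + c" using n by (metis evenE mult_2)
  have "1 - a / 2 \<le> x \<bullet> shrink a J \<omega> x"
    using mult_left_mono[OF less_imp_le[OF small_form] a] x
    by (simp add: inner_shrink dot_square_norm power2_eq_square)
  then have "(1 - a / 2) ^ n \<le> (x \<bullet> shrink a J \<omega> x) ^ n"
    using a2 by (intro power_mono) auto
  also have "\<dots> \<le> B.moment x n"
    by (rule B.moment_power_le[OF x(2)])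
  also have "\<dots> \<le> (\<Sum>p\<in>K. (norm ((shrink a J \<omega> ^^ c) (V p)))\<^sup>2)"
    unfolding c B.moment_even using norm_le_frobenius[OF B.linear_funpow x(1), of c] x(2) by simp
  also have "\<dots> = potential a n J \<omega>"
    unfolding potential_def c B.moment_even[symmetric] by (simp add: B.moment_def)
  finally show ?thesis .
qed

text \<open>Markov's inequality is applied to the potential for each large even \<open>n\<close>,
  and then \<open>n\<close> tends to infinity. The potential starts at \<open>card K\<close>,
  shrinks in mean at each of the \<open>l\<close> draws, and is at least
  \<open>(1 - a / 2) ^ n\<close> on the bad event.\<close>

theorem matrix_chernoff_lower:
  assumes l: "CARD('l::finite) = l"
  shows "measure_pmf.prob (Pi_pmf (UNIV :: 'l set) d (\<lambda>_. q))
    {\<omega>. \<exists>x. P x = x \<and> norm x = 1 \<and> (\<Sum>j\<in>UNIV. (u (\<omega> j) \<bullet> x)\<^sup>2) < 1 / 2}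
    \<le> real (card K) * exp (- (1 / (8 * R)))" (is "measure_pmf.prob ?M ?E \<le> _")
proof -
  have l_pos: "0 < l" using l by (metis zero_less_card_finite)
  \<comment> \<open>In the limit the argument gives the exponent
    \<open>- \<theta> / 2 + \<theta>^2 R / 2\<close>. Its minimum, attained at this
    \<open>\<theta>\<close>, is \<open>- 1 / (8 R)\<close>.\<close>
  define \<theta> where "\<theta> = 1 / (2 * R)"
  have \<theta>: "0 < \<theta>" "\<theta> * R = 1 / 2" using R_pos by (auto simp: \<theta>_def)
  define \<beta> where "\<beta> n = 1 - \<theta> / real n * (real l * R)" for n
  define bnd where "bnd n = real (card K) * exp (- (\<theta> * (1 - 1 / (4 * \<beta> n)))) / (1 + (- \<theta> / 2) / real n) ^ n" for n
  have \<beta>_lim: "\<beta> \<longlonglongrightarrow> 1"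
    unfolding \<beta>_def by real_asymp
  have "bnd \<longlonglongrightarrow> real (card K) * exp (- (\<theta> * (1 - 1 / (4 * 1)))) / exp (- \<theta> / 2)"
    unfolding bnd_def
    by (intro tendsto_intros tendsto_exp_limit_sequentially \<beta>_lim) auto
  also have "real (card K) * exp (- (\<theta> * (1 - 1 / (4 * 1)))) / exp (- \<theta> / 2) = real (card K) * exp (- (1 / (8 * R)))"
    by (simp add: exp_diff[symmetric] \<theta>_def field_simps flip: exp_add exp_minus)
  finally have lim: "bnd \<longlonglongrightarrow> real (card K) * exp (- (1 / (8 * R)))" .
  \<comment> \<open>The limit is taken along even \<open>n\<close>, as
    \<open>potential_lower\<close> requires.\<close>
  have even_lim: "(\<lambda>c. bnd (2 * c)) \<longlonglongrightarrow> real (card K) * exp (- (1 / (8 * R)))"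
    using LIMSEQ_subseq_LIMSEQ[OF lim, of "\<lambda>c. 2 * c"] by (simp add: strict_mono_def o_def)
  \<comment> \<open>\<open>\<theta> < real n\<close> keeps \<open>a\<close> at most 1, so that
    \<open>1 - a / 2\<close> is positive, and \<open>1 / 2 < \<beta> n\<close> supplies the
    condition \<open>1 \<le> 4 * \<beta>\<close> of \<open>potential_step\<close>.\<close>
  have bound: "measure_pmf.prob ?M ?E \<le> bnd n"
    if n: "even n" "2 \<le> n" "\<theta> < real n" "1 / 2 < \<beta> n" for n
  proof -
    obtain m where m: "n = m + 2" using n(2) by (metis add.commute le_Suc_ex)
    define a where "a = \<theta> / real n"
    have a: "0 \<le> a" "a * real (m + 2) = \<theta>" "a \<le> 1"
      using \<theta> n by (auto simp: a_def m simp flip: of_nat_Suc of_nat_add)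
    have \<beta>a: "\<beta> n = 1 - a * (real l * R)" by (simp add: \<beta>_def a_def)
    have small: "a * (real l * R) \<le> 1" using \<beta>a n by simp
    define \<kappa> where "\<kappa> = exp (- (a * real (m + 2) * (1 - 1 / (4 * \<beta> n)) / real l))"
    have "measure_pmf.expectation ?M (potential a n UNIV) \<le> \<kappa> ^ CARD('l) * potential a n {} (\<lambda>_ :: 'l. d)"
    proof (rule expectation_Pi_pmf_le_power)
      fix J' :: "'l set" and j and \<omega> :: "'l \<Rightarrow> 'b"
      assume "j \<notin> J'"
      moreover have "card (insert j J') \<le> l"
        unfolding l[symmetric] by (rule card_mono) auto
      ultimately show "measure_pmf.expectation q (\<lambda>i. potential a n (insert j J') (fun_upd \<omega> j i)) \<le> \<kappa> * potential a n J' \<omega>"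
        unfolding m \<kappa>_def using \<beta>a n(4) a \<theta> l_pos by (intro potential_step) (auto simp: m)
    qed (auto simp: \<kappa>_def)
    also have "potential a n {} (\<lambda>_ :: 'l. d) = real (card K)"
    proof -
      have "shrink a ({} :: 'l set) (\<lambda>_. d) = id" by (auto simp: shrink_def)
      then show ?thesis by (simp add: potential_def orthonormal)
    qed
    also have "\<kappa> ^ CARD('l) = exp (- (\<theta> * (1 - 1 / (4 * \<beta> n))))"
      unfolding l using l_pos a(2) by (simp add: \<kappa>_def exp_of_nat_mult[symmetric])
    finally have E: "measure_pmf.expectation ?M (potential a n UNIV) \<le> exp (- (\<theta> * (1 - 1 / (4 * \<beta> n)))) * real (card K)" .
    have "measure_pmf.prob ?M ?E \<le> measure_pmf.expectation ?M (potential a n UNIV) / (1 - a / 2) ^ n"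
    proof (rule prob_le_expectation)
      show "0 < (1 - a / 2) ^ n" using a by simp
      have "psd_operator (shrink a (UNIV :: 'l set) \<omega>)" for \<omega>
        by (rule psd_shrink) (use a small l in auto)
      then show "0 \<le> potential a n (UNIV :: 'l set) \<omega>" for \<omega>
        unfolding potential_def by (intro sum_nonneg) (metis psd_operator.moment_def psd_operator.moment_nonneg)
      show "(1 - a / 2) ^ n \<le> potential a n UNIV \<omega>" if "\<omega> \<in> ?E" for \<omega> :: "'l \<Rightarrow> 'b"
        using that a small l n by (auto intro!: potential_lower)
    qed
    also have "\<dots> \<le> exp (- (\<theta> * (1 - 1 / (4 * \<beta> n)))) * real (card K) / (1 - a / 2) ^ n"
      using a by (intro divide_right_mono E) auto
    also have "\<dots> = bnd n"
      by (simp add: bnd_def a_def mult.commute)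
    finally show ?thesis .
  qed
  show ?thesis
  proof (rule LIMSEQ_le_const[OF even_lim])
    have "eventually (\<lambda>n. 1 / 2 < \<beta> n) sequentially"
      using order_tendstoD(1)[OF \<beta>_lim, of "1/2"] by simp
    then obtain n1 where n1: "\<And>n. n1 \<le> n \<Longrightarrow> 1 / 2 < \<beta> n"
      by (auto simp: eventually_sequentially)
    obtain n2 where n2: "\<theta> < real n2" using reals_Archimedean2 by blast
    have "measure_pmf.prob ?M ?E \<le> bnd (2 * c)" if "n1 + n2 + 1 \<le> c" for c
      using that n2 by (intro bound n1) auto
    then show "\<exists>N. \<forall>c\<ge>N. measure_pmf.prob ?M ?E \<le> bnd (2 * c)" by blast
  qed
qed

end

section \<open>A Bernstein inequality in Hilbert space\<close>

lemma convex_on_power_nonneg: "convex_on {0::real..} (\<lambda>x. x ^ n)"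
  using convex_power_even[of n] convex_power_odd[of n] by (cases "even n") (auto intro: convex_on_subset)

text \<open>The power series of \<open>cosh (sqrt u)\<close> in \<open>u\<close> has nonnegative
  coefficients, and each power is convex on the nonnegative reals.\<close>

lemma cosh_sqrt_convex:
  "convex_on {0..} (\<lambda>u::real. cosh (sqrt u))"
proof -
  have sums: "(\<lambda>n. u ^ n / fact (2 * n)) sums cosh (sqrt u)" if "0 \<le> u" for u :: real
  proof -
    have "(\<lambda>n. if even n then sqrt u ^ n /\<^sub>R fact n else 0) sums cosh (sqrt u)"
      by (rule cosh_converges)
    then have "(\<lambda>n. (if even (2 * n) then sqrt u ^ (2 * n) /\<^sub>R fact (2 * n) else 0)) sums cosh (sqrt u)"
      by (subst sums_mono_reindex) (auto simp: strict_mono_def)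
    moreover have "sqrt u ^ (2 * n) = u ^ n" for n
      using that by (simp add: power_mult)
    ultimately show ?thesis
      by (simp add: divide_inverse mult.commute)
  qed
  show ?thesis
  proof (rule convex_onI)
    fix t x y :: real
    assume t: "0 < t" "t < 1" and xy: "x \<in> {0..}" "y \<in> {0..}"
    let ?z = "(1 - t) *\<^sub>R x + t *\<^sub>R y"
    have z: "0 \<le> ?z" using t xy by simp
    show "cosh (sqrt ?z) \<le> (1 - t) * cosh (sqrt x) + t * cosh (sqrt y)"
    proof (rule sums_le)
      show "?z ^ n / fact (2 * n) \<le> (1 - t) * (x ^ n / fact (2 * n)) + t * (y ^ n / fact (2 * n))" for n
      proof -
        have "?z ^ n \<le> (1 - t) * x ^ n + t * y ^ n"
          using convex_onD[OF convex_on_power_nonneg[of n], of t x y] t xy by simp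
        then show ?thesis
          by (simp add: divide_right_mono flip: add_divide_distrib)
      qed
      show "(\<lambda>n. ?z ^ n / fact (2 * n)) sums cosh (sqrt ?z)"
        using z by (rule sums)
      show "(\<lambda>n. (1 - t) * (x ^ n / fact (2 * n)) + t * (y ^ n / fact (2 * n)))
          sums ((1 - t) * cosh (sqrt x) + t * cosh (sqrt y))"
        using xy by (intro sums_add sums_mult sums) auto
    qed
  qed simp
qed

text \<open>In the addition formula the remainder \<open>sinh h - h\<close> carries the coefficient
  \<open>sinh a\<close>, which is at most \<open>cosh a\<close>. Its absolute value is
  \<open>sinh \<bar>h\<bar> - \<bar>h\<bar>\<close>, which joins \<open>cosh \<bar>h\<bar>\<close>
  to form the exponential.\<close>

lemma cosh_add_le:
  fixes a h :: real
  assumes "0 \<le> a"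
  shows "cosh (a + h) \<le> cosh a + sinh a * h + cosh a * (exp \<bar>h\<bar> - 1 - \<bar>h\<bar>)"
proof -
  have mono: "x \<le> sinh x" if "0 \<le> x" for x :: real
  proof -
    have "((\<lambda>x. sinh x - x) has_real_derivative (cosh x - 1)) (at x)" for x :: real
      by (auto intro!: derivative_eq_intros)
    then have "(\<lambda>x. sinh x - x) 0 \<le> (\<lambda>x. sinh x - x) x"
      by (intro DERIV_nonneg_imp_nondecreasing[OF that]) (metis cosh_real_ge_1 diff_ge_0_iff_ge)
    then show ?thesis by simp
  qed
  have abs: "\<bar>sinh h - h\<bar> = sinh \<bar>h\<bar> - \<bar>h\<bar>"
    using mono[of h] mono[of "- h"] by (cases "0 \<le> h") auto
  have "sinh a * (sinh h - h) \<le> sinh a * \<bar>sinh h - h\<bar>"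
    using assms by (intro mult_left_mono) auto
  also have "\<dots> \<le> cosh a * \<bar>sinh h - h\<bar>"
    using sinh_less_cosh_real[of a] by (intro mult_right_mono) auto
  also have "\<dots> = cosh a * (sinh \<bar>h\<bar> - \<bar>h\<bar>)"
    by (simp only: abs)
  finally have "sinh a * sinh h \<le> sinh a * h + cosh a * (sinh \<bar>h\<bar> - \<bar>h\<bar>)"
    by (simp add: algebra_simps)
  then have "cosh (a + h) \<le> sinh a * h + cosh a * (cosh \<bar>h\<bar> + sinh \<bar>h\<bar> - \<bar>h\<bar>)"
    by (simp add: cosh_add algebra_simps)
  also have "cosh \<bar>h\<bar> + sinh \<bar>h\<bar> = exp \<bar>h\<bar>"
    by (rule cosh_plus_sinh)
  finally show ?thesis by (simp add: algebra_simps)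
qed

text \<open>For fixed \<open>norm x\<close> and \<open>norm h\<close> the left side is convex and the right side affine in
  \<open>x \<bullet> h\<close>, so it suffices to compare them at the extreme values, where \<open>x\<close> and \<open>h\<close>
  are parallel.\<close>

lemma cosh_norm_add_le:
  fixes x h :: "'a::real_inner"
  shows "cosh (norm (x + h)) \<le> cosh (norm x) + sinh (norm x) / norm x * (x \<bullet> h)
    + cosh (norm x) * (exp (norm h) - 1 - norm h)"
proof (cases "x = 0 \<or> h = 0")
  case True
  then show ?thesis
  proof
    assume "x = 0"
    then show ?thesis using cosh_add_le[of 0 "norm h"] by simp
  qed simp
next
  case False
  let ?a = "norm x" and ?b = "norm h" and ?c = "x \<bullet> h"
  have ab: "0 < ?a" "0 < ?b" using False by auto
  have c: "\<bar>?c\<bar> \<le> ?a * ?b" by (rule Cauchy_Schwarz_ineq2)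
  \<comment> \<open>\<open>t\<close> locates \<open>x \<bullet> h\<close> between its extreme values
    \<open>- (?a * ?b)\<close> and \<open>?a * ?b\<close>; the squared norm of \<open>x + h\<close>
    is the same convex combination of its values there.\<close>
  define t where "t = (1 + ?c / (?a * ?b)) / 2"
  have t: "0 \<le> t" "t \<le> 1"
    using c ab by (auto simp: t_def field_simps abs_le_iff)
  have ct: "?c = (2 * t - 1) * (?a * ?b)"
    using ab by (simp add: t_def field_simps)
  have "(norm (x + h))\<^sup>2 = ?a\<^sup>2 + 2 * ?c + ?b\<^sup>2"
    by (simp only: power2_norm_eq_inner inner_add_left inner_add_right inner_commute[of h x])
  also have "\<dots> = (1 - t) *\<^sub>R (?a - ?b)\<^sup>2 + t *\<^sub>R (?a + ?b)\<^sup>2"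
    by (simp add: ct power2_eq_square algebra_simps)
  finally have n: "norm (x + h) = sqrt ((1 - t) *\<^sub>R (?a - ?b)\<^sup>2 + t *\<^sub>R (?a + ?b)\<^sup>2)"
    by (metis norm_ge_zero real_sqrt_unique)
  let ?E = "cosh ?a * (exp ?b - 1 - ?b)"
  have "cosh (norm (x + h)) \<le> (1 - t) * cosh (sqrt ((?a - ?b)\<^sup>2)) + t * cosh (sqrt ((?a + ?b)\<^sup>2))"
    unfolding n by (rule convex_onD[OF cosh_sqrt_convex]) (use t in auto)
  also have "\<dots> = (1 - t) * cosh (?a + - ?b) + t * cosh (?a + ?b)"
    using ab by simp
  also have "\<dots> \<le> (1 - t) * (cosh ?a + sinh ?a * (- ?b) + ?E) + t * (cosh ?a + sinh ?a * ?b + ?E)"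
    using t cosh_add_le[of ?a ?b] cosh_add_le[of ?a "- ?b"] by (intro add_mono mult_left_mono) auto
  also have "\<dots> = cosh ?a + sinh ?a / ?a * ((2 * t - 1) * (?a * ?b)) + ?E"
    using ab by (simp add: field_simps)
  finally show ?thesis by (simp only: ct)
qed

text \<open>The tail of the exponential series is dominated by a geometric series of ratio
  \<open>y / 3\<close>, because \<open>fact (n + 2)\<close> is at least
  \<open>2 * 3 ^ n\<close>.\<close>

lemma exp_bernstein_bound:
  fixes y :: real
  assumes "0 \<le> y" "y < 3"
  shows "exp y - 1 - y \<le> y\<^sup>2 / (2 * (1 - y / 3))"
proof -
  have fact_ge: "2 * 3 ^ n \<le> (fact (n + 2) :: real)" for n
  proof (induction n)
    case (Suc n)
    have "2 * 3 ^ Suc n = 3 * (2 * 3 ^ n :: real)" by simp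
    also have "\<dots> \<le> (real (n + 3)) * fact (n + 2)"
      using Suc by (intro mult_mono) auto
    finally show ?case by (simp add: algebra_simps)
  qed (simp add: numeral_2_eq_2)
  have s1: "(\<lambda>n. y ^ (n + 2) /\<^sub>R fact (n + 2)) sums (exp y - (\<Sum>i<2. y ^ i /\<^sub>R fact i))"
    by (rule sums_split_initial_segment[OF exp_converges])
  have s2: "(\<lambda>n. y\<^sup>2 / 2 * (y / 3) ^ n) sums (y\<^sup>2 / 2 * (1 / (1 - y / 3)))"
    using assms by (intro sums_mult geometric_sums) auto
  have "exp y - (\<Sum>i<2. y ^ i /\<^sub>R fact i) \<le> y\<^sup>2 / 2 * (1 / (1 - y / 3))"
  proof (rule sums_le[OF _ s1 s2])
    fix n
    have "y ^ (n + 2) /\<^sub>R fact (n + 2) = y ^ (n + 2) / fact (n + 2)"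
      by (simp add: divide_inverse mult.commute)
    also have "\<dots> \<le> y ^ (n + 2) / (2 * 3 ^ n)"
      using fact_ge[of n] assms by (intro divide_left_mono) auto
    also have "\<dots> = y\<^sup>2 / 2 * (y / 3) ^ n"
      by (simp add: power_add power_divide power2_eq_square)
    finally show "y ^ (n + 2) /\<^sub>R fact (n + 2) \<le> y\<^sup>2 / 2 * (y / 3) ^ n" .
  qed
  then show ?thesis
    by (simp add: numeral_2_eq_2)
qed

text \<open>The potential is \<open>cosh\<close> of the scaled norm of the partial sum. Its
  first-order change averages to 0 by \<open>mean\<close> and the remainder is governed by the
  variance, so no dimension enters. The factor 2 comes from
  \<open>exp x \<le> 2 cosh x\<close>.\<close>

theorem vector_bernstein:
  fixes q :: "'b::finite pmf" and Z :: "'b \<Rightarrow> 'a::real_inner"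
  assumes mean: "(\<Sum>i\<in>UNIV. pmf q i *\<^sub>R Z i) = 0"
    and bound: "\<And>i. norm (Z i) \<le> L"
    and var: "real CARD('l::finite) * (\<Sum>i\<in>UNIV. pmf q i * (norm (Z i))\<^sup>2) \<le> \<nu>"
    and pos: "0 < \<nu>" "0 < u"
  shows "measure_pmf.prob (Pi_pmf (UNIV :: 'l set) d (\<lambda>_. q))
     {\<omega>. sqrt (2 * \<nu> * u) + L * u / 3 < norm (\<Sum>j\<in>UNIV. Z (\<omega> j))} \<le> 2 * exp (- u)"
proof -
  let ?l = "real CARD('l)" and ?t = "sqrt (2 * \<nu> * u) + L * u / 3"
  have L: "0 \<le> L" using bound norm_ge_zero order_trans by blast
  define s where "s = sqrt (2 * u / \<nu>)"
  have s: "0 < s" using pos by (simp add: s_def)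
  have s2: "s\<^sup>2 * \<nu> = 2 * u" using pos by (simp add: s_def)
  have st: "s * sqrt (2 * \<nu> * u) = 2 * u"
  proof -
    have "s * sqrt (2 * \<nu> * u) = sqrt ((2 * u)\<^sup>2)"
      unfolding s_def real_sqrt_mult[symmetric] using pos by (simp add: power2_eq_square)
    also have "\<dots> = 2 * u" using pos by (intro real_sqrt_unique) auto
    finally show ?thesis .
  qed
  \<comment> \<open>\<open>s\<close> minimises the exponent in the case \<open>L = 0\<close>. The
    denominator corrects for the size of the summands: it keeps \<open>\<tau> * L\<close> below 3
    and makes the final exponent exactly \<open>- u\<close>.\<close>
  define \<tau> where "\<tau> = s / (1 + s * L / 3)"
  have den: "0 < 1 + s * L / 3" using s L by (simp add: add_pos_nonneg)
  have \<tau>: "0 < \<tau>" using s den by (simp add: \<tau>_def)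
  have gap: "1 - \<tau> * L / 3 = 1 / (1 + s * L / 3)"
    using den by (simp add: \<tau>_def field_simps)
  then have gap_pos: "0 < 1 - \<tau> * L / 3" using den by simp
  define D where "D = 2 * (1 - \<tau> * L / 3)"
  have D: "0 < D" unfolding D_def by (intro mult_pos_pos gap_pos) simp
  have exponent: "\<tau>\<^sup>2 * \<nu> / D - \<tau> * ?t = - u"
  proof -
    let ?D = "1 + s * L / 3"
    have "\<tau>\<^sup>2 * \<nu> / D = (s\<^sup>2 * \<nu>) / (2 * ?D)"
      unfolding D_def gap using den by (simp add: \<tau>_def power_divide power2_eq_square)
    also have "\<dots> = u / ?D"
      unfolding s2 by (rule mult_divide_mult_cancel_left) simp
    finally have 1: "\<tau>\<^sup>2 * \<nu> / D = u / ?D" .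
    have "\<tau> * ?t = s * ?t / ?D"
      by (simp only: \<tau>_def times_divide_eq_left)
    also have "s * ?t = s * sqrt (2 * \<nu> * u) + s * L / 3 * u"
      by (simp add: algebra_simps)
    also have "\<dots> = u + u * ?D"
      unfolding st by (simp add: algebra_simps)
    also have "\<dots> / ?D = u / ?D + u"
      unfolding add_divide_distrib using den by simp
    finally show ?thesis using 1 by simp
  qed
  define \<Phi> where "\<Phi> J \<omega> = cosh (\<tau> * norm (\<Sum>j\<in>J. Z (\<omega> j)))" for J :: "'l set" and \<omega>
  define \<kappa> where "\<kappa> = exp (\<tau>\<^sup>2 * \<nu> / D / ?l)"
  have step: "measure_pmf.expectation q (\<lambda>i. \<Phi> (insert j J) (fun_upd \<omega> j i)) \<le> \<kappa> * \<Phi> J \<omega>"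
    if "j \<notin> J" for J j \<omega>
  proof -
    let ?S = "\<Sum>j\<in>J. Z (\<omega> j)"
    let ?x = "\<tau> *\<^sub>R ?S"
    have ins: "(\<Sum>j'\<in>insert j J. Z (fun_upd \<omega> j i j')) = ?S + Z i" for i
    proof -
      have "(\<Sum>j'\<in>J. Z (fun_upd \<omega> j i j')) = ?S"
        using that by (intro sum.cong) auto
      then show ?thesis using that by simp
    qed
    have \<Phi>': "\<Phi> J \<omega> = cosh (norm ?x)"
      using \<tau> by (simp add: \<Phi>_def)
    have "\<Phi> (insert j J) (fun_upd \<omega> j i) \<le> cosh (norm ?x) + sinh (norm ?x) / norm ?x * (?x \<bullet> (\<tau> *\<^sub>R Z i))
        + cosh (norm ?x) * (\<tau>\<^sup>2 * (norm (Z i))\<^sup>2 / D)" for i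
    proof -
      let ?h = "\<tau> *\<^sub>R Z i"
      have h: "norm ?h \<le> \<tau> * L" using bound[of i] \<tau> by simp
      have h3: "norm ?h < 3" using h gap_pos by linarith
      have "exp (norm ?h) - 1 - norm ?h \<le> (norm ?h)\<^sup>2 / (2 * (1 - norm ?h / 3))"
        by (rule exp_bernstein_bound) (use h3 in auto)
      also have "\<dots> \<le> (norm ?h)\<^sup>2 / D"
        unfolding D_def using h h3 gap_pos by (intro divide_left_mono mult_pos_pos mult_left_mono) auto
      also have "\<dots> = \<tau>\<^sup>2 * (norm (Z i))\<^sup>2 / D"
        by (simp add: power_mult_distrib)
      finally have *: "cosh (norm ?x) * (exp (norm ?h) - 1 - norm ?h) \<le> cosh (norm ?x) * (\<tau>\<^sup>2 * (norm (Z i))\<^sup>2 / D)"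
        by (intro mult_left_mono) auto
      have "\<Phi> (insert j J) (fun_upd \<omega> j i) = cosh (norm (?x + ?h))"
        using \<tau> unfolding \<Phi>_def ins by (simp flip: scaleR_add_right)
      then show ?thesis
        using cosh_norm_add_le[of ?x ?h] * by linarith
    qed
    then have "measure_pmf.expectation q (\<lambda>i. \<Phi> (insert j J) (fun_upd \<omega> j i))
      \<le> (\<Sum>i\<in>UNIV. pmf q i * (cosh (norm ?x) + sinh (norm ?x) / norm ?x * (?x \<bullet> (\<tau> *\<^sub>R Z i))
        + cosh (norm ?x) * (\<tau>\<^sup>2 * (norm (Z i))\<^sup>2 / D)))"
      unfolding expectation_finite_pmf by (intro sum_mono mult_left_mono) auto
    also have "\<dots> = cosh (norm ?x) * (\<Sum>i\<in>UNIV. pmf q i)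
        + sinh (norm ?x) / norm ?x * (?x \<bullet> (\<tau> *\<^sub>R (\<Sum>i\<in>UNIV. pmf q i *\<^sub>R Z i)))
        + cosh (norm ?x) * (\<tau>\<^sup>2 / D * (\<Sum>i\<in>UNIV. pmf q i * (norm (Z i))\<^sup>2))"
      by (simp only: sum_distrib_left inner_sum_right scaleR_sum_right sum.distrib[symmetric])
        (intro sum.cong, simp_all add: algebra_simps)
    also have "\<dots> = \<Phi> J \<omega> * (1 + \<tau>\<^sup>2 / D * (\<Sum>i\<in>UNIV. pmf q i * (norm (Z i))\<^sup>2))"
      unfolding mean \<Phi>' by (simp add: sum_pmf_eq_1 distrib_left)
    also have "\<dots> \<le> \<Phi> J \<omega> * (1 + \<tau>\<^sup>2 / D * (\<nu> / ?l))"
      using var D by (intro mult_left_mono add_left_mono) (auto simp: \<Phi>_def pos_le_divide_eq mult.commute)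
    also have "\<dots> \<le> \<Phi> J \<omega> * \<kappa>"
      unfolding \<kappa>_def using exp_ge_add_one_self[of "\<tau>\<^sup>2 * \<nu> / D / ?l"]
      by (intro mult_left_mono) (auto simp: \<Phi>_def)
    finally show ?thesis by (simp add: mult.commute)
  qed
  let ?M = "Pi_pmf (UNIV :: 'l set) d (\<lambda>_. q)"
  have E: "measure_pmf.expectation ?M (\<Phi> UNIV) \<le> \<kappa> ^ CARD('l) * \<Phi> {} (\<lambda>_. d)"
    by (rule expectation_Pi_pmf_le_power) (simp, simp add: \<kappa>_def, rule step)
  also have "\<dots> = exp (\<tau>\<^sup>2 * \<nu> / D)"
    by (simp add: \<Phi>_def \<kappa>_def exp_of_nat_mult[symmetric])
  finally have E: "measure_pmf.expectation ?M (\<Phi> UNIV) \<le> exp (\<tau>\<^sup>2 * \<nu> / D)" .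
  have "measure_pmf.prob ?M {\<omega>. ?t < norm (\<Sum>j\<in>UNIV. Z (\<omega> j))}
      \<le> measure_pmf.expectation ?M (\<Phi> UNIV) / (exp (\<tau> * ?t) / 2)"
  proof (rule prob_le_expectation)
    fix \<omega> :: "'l \<Rightarrow> 'b" assume "\<omega> \<in> {\<omega>. ?t < norm (\<Sum>j\<in>UNIV. Z (\<omega> j))}"
    then have "exp (\<tau> * ?t) \<le> exp (\<tau> * norm (\<Sum>j\<in>UNIV. Z (\<omega> j)))"
      using \<tau> by simp
    also have "\<dots> \<le> 2 * \<Phi> UNIV \<omega>"
      by (simp add: \<Phi>_def cosh_field_def)
    finally show "exp (\<tau> * ?t) / 2 \<le> \<Phi> UNIV \<omega>" by simp
  qed (auto simp: \<Phi>_def)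
  also have "\<dots> \<le> exp (\<tau>\<^sup>2 * \<nu> / D) / (exp (\<tau> * ?t) / 2)"
    by (intro divide_right_mono E) auto
  also have "\<dots> = 2 * exp (\<tau>\<^sup>2 * \<nu> / D - \<tau> * ?t)"
    by (simp add: exp_diff)
  finally show ?thesis unfolding exponent .
qed

section \<open>Existence of best approximations\<close>

text \<open>Here \<open>norm\<close> is the Frobenius norm. Only the equivalence of the two norms is
  used, to move between spectral errors and the topology of the matrix space, so a crude constant
  suffices.\<close>

lemma spectral_norm_le_norm:
  "spectral_norm M \<le> real CARD('m) * real CARD('n) * norm (M :: real^'n^'m)"
proof -
  have "\<bar>M $ i $ j\<bar> \<le> norm M" for i j
    by (meson Finite_Cartesian_Product.norm_nth_le component_le_norm_cart order_trans)
  then show ?thesis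
    unfolding spectral_norm_def by (rule onorm_le_matrix_component)
qed

text \<open>Rank is lower semicontinuous: \<open>X\<close> is injective, hence bounded below, on its
  row space, and a sufficiently close \<open>Y\<close> remains injective there, so its rank is no
  smaller.\<close>

lemma closed_rank_le: "closed {X :: real^'n^'m. rank X \<le> k}"
proof -
  let ?S = "{X :: real^'n^'m. \<not> rank X \<le> k}"
  have "open ?S"
  proof (rule openI)
    fix X :: "real^'n^'m" assume "X \<in> ?S"
    then have k: "k < rank X" by simp
    let ?T = "span (rows X)"
    have "\<exists>c>0. \<forall>x\<in>?T. norm (X *v x) \<ge> c * norm x"
      by (rule injective_imp_isometric)
        (auto intro: closed_span subspace_span matrix_vector_mul_bounded_linear dest: nullspace_inter_rowspace[THEN iffD1, OF conjI])
    then obtain c where c: "0 < c" "\<And>x. x \<in> ?T \<Longrightarrow> c * norm x \<le> norm (X *v x)"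
      by blast
    define K where "K = real CARD('m) * real CARD('n)"
    have K: "0 < K" "\<And>Y :: real^'n^'m. onorm (\<lambda>x. Y *v x) \<le> K * norm Y"
      using spectral_norm_le_norm by (auto simp: K_def spectral_norm_def)
    show "\<exists>r>0. ball X r \<subseteq> ?S"
    proof (intro exI conjI subsetI)
      show "0 < c / K" using c K by simp
      fix Y assume "Y \<in> ball X (c / K)"
      then have XY: "K * norm (X - Y) < c"
        using K by (simp add: dist_norm field_simps)
      have inj: "x = 0" if x: "x \<in> ?T" and Y: "Y *v x = 0" for x
      proof (rule ccontr)
        assume "x \<noteq> 0"
        have "c * norm x \<le> norm ((X - Y) *v x)"
          using c(2)[OF x] by (simp add: matrix_vector_mult_diff_rdistrib Y)
        also have "\<dots> \<le> onorm (\<lambda>x. (X - Y) *v x) * norm x"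
          by (intro onorm matrix_vector_mul_bounded_linear)
        also have "\<dots> \<le> (K * norm (X - Y)) * norm x"
          by (intro mult_right_mono K) auto
        also have "\<dots> < c * norm x"
          using XY \<open>x \<noteq> 0\<close> by (intro mult_strict_right_mono) auto
        finally show False by simp
      qed
      have "inj_on (\<lambda>x. Y *v x) ?T"
        by (subst linear_inj_on_iff_eq_0) (auto intro: inj subspace_span)
      then have "dim ((\<lambda>x. Y *v x) ` ?T) = dim ?T"
        by (intro dim_image_eq) (auto simp: span_span)
      moreover have "dim ((\<lambda>x. Y *v x) ` ?T) \<le> dim (range (\<lambda>x. Y *v x))"
        by (intro dim_subset) auto
      ultimately have "rank X \<le> rank Y"
        by (simp add: rank_dim_range[of Y] row_rank_def[of X])
      then show "Y \<in> ?S" using k by simp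
    qed
  qed
  then show ?thesis
    using closed_Collect_neg by fastforce
qed

lemma spectral_norm_triangle_diff: "spectral_norm X \<le> spectral_norm (X - Y) + spectral_norm Y"
proof -
  have "onorm (\<lambda>x. (X - Y) *v x + Y *v x) \<le> onorm (\<lambda>x. (X - Y) *v x) + onorm (\<lambda>x. Y *v x)"
    by (intro onorm_triangle matrix_vector_mul_bounded_linear)
  then show ?thesis
    by (simp add: spectral_norm_def matrix_vector_mult_diff_rdistrib)
qed

lemma norm_le_spectral_norm:
  "norm M \<le> real CARD('m) * real CARD('n) * spectral_norm (M :: real^'n^'m)"
proof -
  have "\<bar>M $ i $ j\<bar> \<le> spectral_norm M" for i j
    unfolding spectral_norm_def by (rule matrix_component_le_onorm)
  then have row: "norm (M $ i) \<le> real CARD('n) * spectral_norm M" for i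
    using order_trans[OF norm_le_l1_cart[of "M $ i"] sum_bounded_above[of UNIV "\<lambda>j. \<bar>M $ i $ j\<bar>" "spectral_norm M"]]
    by simp
  have "norm M \<le> (\<Sum>i\<in>UNIV. norm (M $ i))"
    unfolding norm_vec_def by (rule L2_set_le_sum) simp
  also have "\<dots> \<le> real CARD('m) * (real CARD('n) * spectral_norm M)"
    using sum_bounded_above[of UNIV "\<lambda>i. norm (M $ i)" "real CARD('n) * spectral_norm M"] row by simp
  finally show ?thesis by simp
qed

lemma continuous_on_spectral_norm: "continuous_on S (\<lambda>X :: real^'n^'m. spectral_norm (A - X))"
proof -
  have lip: "\<bar>spectral_norm X - spectral_norm Y\<bar> \<le> real CARD('m) * real CARD('n) * norm (X - Y)" for X Y :: "real^'n^'m"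
  proof -
    have "norm (Y - X) = norm (X - Y)" by (rule norm_minus_commute)
    then show ?thesis
      using spectral_norm_le_norm[of "X - Y"] spectral_norm_le_norm[of "Y - X"]
        spectral_norm_triangle_diff[of X Y] spectral_norm_triangle_diff[of Y X]
      by simp
  qed
  let ?K = "real CARD('m) * real CARD('n)"
  show ?thesis
    unfolding continuous_on_iff
  proof (intro ballI allI impI)
    fix X :: "real^'n^'m" and e :: real assume e: "0 < e"
    show "\<exists>d>0. \<forall>Y\<in>S. dist Y X < d \<longrightarrow> dist (spectral_norm (A - Y)) (spectral_norm (A - X)) < e"
    proof (intro exI conjI ballI impI)
      show "0 < e / ?K" using e by simp
      fix Y assume "dist Y X < e / ?K"
      then have "?K * norm (X - Y) < e"
        by (simp add: dist_norm field_simps norm_minus_commute)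
      then show "dist (spectral_norm (A - Y)) (spectral_norm (A - X)) < e"
        using lip[of "A - Y" "A - X"] by (simp add: dist_real_def)
    qed
  qed
qed

lemma columns_subset_iff: "columns X \<subseteq> S \<longleftrightarrow> (\<forall>j. column j X \<in> S)"
  by (auto simp: columns_def)

text \<open>\<open>best_approx\<close> is a choice, so it is a minimiser only once a minimiser is
  shown to exist; this follows by compactness.\<close>

lemma best_approx_le:
  fixes A X :: "real^'n^'m" and C :: "real^'l^'m"
  assumes "columns X \<subseteq> span (columns C)" "rank X \<le> k"
  shows "spectral_norm (A - best_approx C k A) \<le> spectral_norm (A - X)"
proof -
  let ?S = "{X :: real^'n^'m. columns X \<subseteq> span (columns C) \<and> rank X \<le> k}"
  let ?f = "\<lambda>X. spectral_norm (A - X)"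
  let ?K = "real CARD('m) * real CARD('n)"
  have "closed {X :: real^'n^'m. columns X \<subseteq> span (columns C)}"
  proof -
    have "{X :: real^'n^'m. columns X \<subseteq> span (columns C)} = (\<Inter>j. {X. column j X \<in> span (columns C)})"
      by (auto simp: columns_subset_iff)
    moreover have "closed {X :: real^'n^'m. column j X \<in> span (columns C)}" for j
    proof -
      have "continuous_on UNIV (\<lambda>X :: real^'n^'m. \<chi> i. X $ i $ j)"
        by (intro continuous_intros)
      from closed_vimage[OF closed_span[of "columns C"] this] show ?thesis
        by (simp add: vimage_def column_def)
    qed
    ultimately show ?thesis by auto
  qed
  then have cl: "closed ?S"
    using closed_rank_le[of k] by (auto simp: Collect_conj_eq)
  \<comment> \<open>The candidate set is closed but unbounded. Outside this ball the error exceeds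
    that of \<open>X\<close> by the norm comparison, so a minimum over the compact part is
    global.\<close>
  let ?D = "?S \<inter> cball A (?K * ?f X)"
  have "compact ?D"
    using cl by (simp add: closed_Int_compact)
  moreover have XD: "X \<in> ?D"
    using assms norm_le_spectral_norm[of "A - X"] by (simp add: dist_norm)
  ultimately obtain Y where Y: "Y \<in> ?D" "\<And>Z. Z \<in> ?D \<Longrightarrow> ?f Y \<le> ?f Z"
    using continuous_attains_inf[of ?D ?f] continuous_on_spectral_norm by blast
  have "?f Y \<le> ?f Z" if "Z \<in> ?S" for Z
  proof (cases "Z \<in> ?D")
    case False
    then have "?K * ?f X < norm (A - Z)"
      using that by (simp add: dist_norm not_le)
    also have "\<dots> \<le> ?K * ?f Z"
      by (rule norm_le_spectral_norm)
    finally have "?f X < ?f Z"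
      by (simp add: mult_less_cancel_left)
    then show ?thesis using Y(2)[OF XD] by simp
  qed (use Y in auto)
  then have "is_arg_min ?f (\<lambda>X. X \<in> ?S) Y"
    using Y(1) by (auto simp: is_arg_min_linorder)
  then have "is_arg_min ?f (\<lambda>X. X \<in> ?S) (best_approx C k A)"
    unfolding best_approx_def arg_min_def by (metis (mono_tags, lifting) mem_Collect_eq someI_ex is_arg_min_def)
  then show ?thesis
    using assms by (auto simp: is_arg_min_linorder)
qed

section \<open>The deterministic error bound\<close>

lemma thin_svd_mult:
  assumes "thin_svd A r U \<sigma> V"
  shows "A *v x = (\<Sum>p<r. (\<sigma> p * (V p \<bullet> x)) *\<^sub>R U p)"
proof (subst vec_eq_iff, rule allI)
  fix i
  have "(A *v x) $ i = (\<Sum>j\<in>UNIV. \<Sum>p<r. U p $ i * \<sigma> p * V p $ j * x $ j)"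
    using assms by (simp add: thin_svd_def matrix_vector_mult_def sum_distrib_right)
  also have "\<dots> = (\<Sum>p<r. (\<sigma> p * (V p \<bullet> x)) * U p $ i)"
    by (subst sum.swap) (simp add: inner_vec_def sum_distrib_left mult_ac)
  finally show "(A *v x) $ i = (\<Sum>p<r. (\<sigma> p * (V p \<bullet> x)) *\<^sub>R U p) $ i"
    by simp
qed

lemma thin_svd_orthonormal:
  assumes "thin_svd A r U \<sigma> V" "K \<subseteq> {..<r}"
  shows "orthonormal_family U K" "orthonormal_family V K"
proof -
  have "finite K"
    using assms(2) by (rule finite_subset) simp
  then show "orthonormal_family U K" "orthonormal_family V K"
    using assms by (auto simp: thin_svd_def orthonormal_family_def subset_iff)
qed

text \<open>On the span of \<open>V\<^sub>2\<close> only the singular values with index at least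
  \<open>k\<close> act, and \<open>\<sigma> k\<close> is the largest of them.\<close>

lemma norm_mult_tail_le:
  assumes svd: "thin_svd A r U \<sigma> V" and k: "k < r"
    and x: "ortho_proj V {k..<r} x = x"
  shows "norm (A *v x) \<le> \<sigma> k * norm x"
proof -
  interpret U: orthonormal_family U "{..<r}" by (rule thin_svd_orthonormal(1)[OF svd]) simp
  interpret V: orthonormal_family V "{..<r}" by (rule thin_svd_orthonormal(2)[OF svd]) simp
  interpret V2: orthonormal_family V "{k..<r}" by (rule thin_svd_orthonormal(2)[OF svd]) auto
  have \<sigma>: "0 \<le> \<sigma> p" "k \<le> p \<Longrightarrow> \<sigma> p \<le> \<sigma> k" if "p < r" for p
    using svd k that by (auto simp: thin_svd_def)
  have zero: "V p \<bullet> x = 0" if "p < k" for p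
  proof -
    have "V p \<bullet> x = (\<Sum>q\<in>{k..<r}. (V p \<bullet> V q) * (V q \<bullet> x))"
      using V2.inner_proj_right[of "V p" x] x by simp
    also have "\<dots> = 0"
      using that k by (intro sum.neutral) (auto simp: V.orthonormal)
    finally show ?thesis .
  qed
  have "(norm (A *v x))\<^sup>2 = (\<Sum>p<r. (\<sigma> p * (V p \<bullet> x))\<^sup>2)"
    unfolding thin_svd_mult[OF svd] by (rule U.norm_combination)
  also have "\<dots> = (\<Sum>p\<in>{k..<r}. (\<sigma> p * (V p \<bullet> x))\<^sup>2)"
    by (intro sum.mono_neutral_right) (auto simp: zero)
  also have "\<dots> \<le> (\<Sum>p\<in>{k..<r}. (\<sigma> k)\<^sup>2 * (V p \<bullet> x)\<^sup>2)"
    unfolding power_mult_distrib using \<sigma> by (intro sum_mono mult_right_mono power_mono) auto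
  also have "\<dots> = (\<sigma> k)\<^sup>2 * (norm (ortho_proj V {k..<r} x))\<^sup>2"
    by (simp add: V2.norm_proj sum_distrib_left)
  finally have "(norm (A *v x))\<^sup>2 \<le> (\<sigma> k * norm x)\<^sup>2"
    by (simp add: x power_mult_distrib)
  then show ?thesis
    using \<sigma>(1)[OF k] by (simp add: power2_le_iff_abs_le)
qed

text \<open>The family \<open>V\<close> need not span the whole space, but \<open>A\<close> vanishes
  on the orthogonal complement of its span.\<close>

lemma thin_svd_mult_split:
  assumes svd: "thin_svd A r U \<sigma> V" and k: "k \<le> r"
  shows "A *v x = A *v (ortho_proj V {..<k} x + ortho_proj V {k..<r} x)"
proof -
  interpret V: orthonormal_family V "{..<r}" by (rule thin_svd_orthonormal(2)[OF svd]) simp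
  have "{..<k} \<union> {k..<r} = {..<r}" using k by auto
  then have "ortho_proj V {..<k} x + ortho_proj V {k..<r} x = V.P x"
    using sum.union_disjoint[of "{..<k}" "{k..<r}" "\<lambda>p. (V p \<bullet> x) *\<^sub>R V p"]
    by (simp add: ortho_proj_def ivl_disj_int)
  moreover have "A *v V.P x = A *v x"
    unfolding thin_svd_mult[OF svd] by (intro sum.cong) (auto simp: V.inner_basis_proj)
  ultimately show ?thesis by simp
qed

text \<open>The approximation is \<open>A \<Omega> (V\<^sub>1\<^sup>T \<Omega>)\<^sup>+ V\<^sub>1\<^sup>T\<close>, where the columns of \<open>\<Omega>\<close> are the sampled coordinate
  vectors scaled by \<open>sqrt (r i)\<close>.\<close>

lemma sampled_approx_exists:
  fixes A :: "real^'n^'m" and \<omega> :: "'l::finite \<Rightarrow> 'n" and r :: "'n \<Rightarrow> real"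
  assumes svd: "thin_svd A \<rho> U \<sigma> V" and k: "k < \<rho>" and t: "0 \<le> t"
  defines "w \<equiv> \<lambda>j. ortho_proj V {..<k} (axis (\<omega> j) 1)"
    and "z \<equiv> \<lambda>j. ortho_proj V {k..<\<rho>} (axis (\<omega> j) 1)"
  assumes gram: "\<And>x. ortho_proj V {..<k} x = x \<Longrightarrow> (norm x)\<^sup>2 / 2 \<le> (\<Sum>j\<in>UNIV. r (\<omega> j) * (w j \<bullet> x)\<^sup>2)"
    and cross: "\<And>y. norm (\<Sum>j\<in>UNIV. (r (\<omega> j) * (w j \<bullet> y)) *\<^sub>R z j) \<le> t * norm y"
  shows "\<exists>X. columns X \<subseteq> span (columns (sampled_columns A \<omega>)) \<and> rank X \<le> k \<and>
    spectral_norm (A - X) \<le> \<sigma> k * (1 + 2 * t)"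
proof -
  interpret V1: orthonormal_family V "{..<k}" by (rule thin_svd_orthonormal(2)[OF svd]) (use k in auto)
  interpret V2: orthonormal_family V "{k..<\<rho>}" by (rule thin_svd_orthonormal(2)[OF svd]) (use k in auto)
  define G where "G x = (\<Sum>j\<in>UNIV. (r (\<omega> j) * (w j \<bullet> x)) *\<^sub>R w j)" for x
  have w_proj: "V1.P (w j) = w j" for j by (simp add: w_def V1.proj_idem)
  have z_proj: "V2.P (z j) = z j" for j by (simp add: z_def V2.proj_idem)
  have linG: "linear G"
    unfolding G_def
    by (intro linearI) (simp_all add: inner_add_right algebra_simps sum.distrib scaleR_sum_right)
  have G_proj: "V1.P (G x) = G x" for x
    unfolding G_def by (simp add: linear_sum[OF V1.linear_proj] linear_scale[OF V1.linear_proj] w_proj)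
  have G_of_proj: "G (V1.P x) = G x" for x
  proof -
    have "w j \<bullet> V1.P x = w j \<bullet> x" for j
      by (metis V1.proj_sym w_proj)
    then show ?thesis unfolding G_def by simp
  qed
  \<comment> \<open>Adding the identity on the complement of the span of \<open>V\<^sub>1\<close>
    makes the Gram operator coercive on the whole space, hence invertible. Its inverse
    \<open>H\<close> supplies the pseudo-inverse.\<close>
  define G' where "G' x = G x + (x - V1.P x)" for x
  have linG': "linear G'"
    unfolding G'_def by (intro linear_compose_add linear_compose_sub linG V1.linear_proj linear_ident)
  have coercive: "(norm x)\<^sup>2 / 2 \<le> x \<bullet> G' x" for x
  proof -
    have "x \<bullet> G x = V1.P x \<bullet> G (V1.P x)"
      by (metis G_of_proj G_proj V1.proj_sym)
    also have "\<dots> = (\<Sum>j\<in>UNIV. r (\<omega> j) * (w j \<bullet> V1.P x)\<^sup>2)"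
      unfolding G_def by (simp add: inner_sum_right power2_eq_square inner_commute mult_ac)
    finally have "(norm (V1.P x))\<^sup>2 / 2 \<le> x \<bullet> G x"
      using gram[OF V1.proj_idem] by simp
    moreover have "x \<bullet> G' x = x \<bullet> G x + (norm x)\<^sup>2 - (norm (V1.P x))\<^sup>2"
      by (simp add: G'_def inner_add_right inner_diff_right V1.inner_proj_self dot_square_norm)
    moreover have "(norm (V1.P x))\<^sup>2 \<le> (norm x)\<^sup>2"
      by (intro power_mono V1.norm_proj_le) auto
    ultimately show ?thesis by linarith
  qed
  have "inj G'"
  proof (subst linear_injective_0[OF linG'], intro allI impI)
    fix x assume "G' x = 0"
    then show "x = 0" using coercive[of x] by simp
  qed
  then obtain H where linH: "linear H" and H: "\<And>x. G' (H x) = x"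
    using linear_injective_isomorphism[OF linG'] by metis
  \<comment> \<open>The coercivity constant 1/2 gives the factor 2, which becomes the 2 in
    \<open>1 + 2 * t\<close>.\<close>
  have norm_H: "norm (H x) \<le> 2 * norm x" for x
  proof (cases "H x = 0")
    case False
    have "norm (H x) * norm (H x) \<le> norm (H x) * (2 * norm x)"
      using coercive[of "H x"] norm_cauchy_schwarz[of "H x" x] by (simp add: H power2_eq_square)
    then show ?thesis using False by simp
  qed simp
  define f where "f y = (\<Sum>j\<in>UNIV. (r (\<omega> j) * (w j \<bullet> H y)) *\<^sub>R (A *v axis (\<omega> j) 1))" for y
  have linf: "linear f"
    unfolding f_def
    by (intro linearI) (simp_all add: linear_add[OF linH] linear_scale[OF linH]
        inner_add_right algebra_simps sum.distrib scaleR_sum_right)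
  have linX: "linear (\<lambda>x. f (V1.P x))"
    using linear_compose[OF V1.linear_proj linf] by (simp add: o_def)
  define X where "X = matrix (\<lambda>x. f (V1.P x))"
  have X: "X *v x = f (V1.P x)" for x
    using matrix_works[of "\<lambda>x. f (V1.P x)"] linX by (simp add: X_def)
  have col: "column (\<omega> j) A = A *v axis (\<omega> j) 1" for j
    by (simp add: matrix_vector_mult_basis)
  have cols: "columns X \<subseteq> span (columns (sampled_columns A \<omega>))"
  proof -
    have "column j (sampled_columns A \<omega>) = A *v axis (\<omega> j) 1" for j
      unfolding col[symmetric] by (simp add: sampled_columns_def column_def)
    then have "A *v axis (\<omega> j) 1 \<in> columns (sampled_columns A \<omega>)" for j
      by (metis (mono_tags, lifting) UNIV_I columns_def mem_Collect_eq)
    then have "f y \<in> span (columns (sampled_columns A \<omega>))" for y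
      unfolding f_def by (intro span_sum span_scale span_base)
    moreover have "column i X = X *v axis i 1" for i
      by (simp add: matrix_vector_mult_basis)
    ultimately show ?thesis
      by (auto simp: columns_def X)
  qed
  have rank: "rank X \<le> k"
  proof -
    have "V1.P x \<in> span (V ` {..<k})" for x
      unfolding ortho_proj_def by (intro span_sum span_scale span_base) auto
    then have "range (\<lambda>x. X *v x) \<subseteq> f ` span (V ` {..<k})"
      by (auto simp: X)
    then have "rank X \<le> dim (f ` span (V ` {..<k}))"
      unfolding rank_dim_range by (rule dim_subset)
    also have "\<dots> \<le> dim (span (V ` {..<k}))"
      by (rule dim_image_le[OF linf])
    also have "\<dots> \<le> card (V ` {..<k})"
      by (simp add: dim_le_card')
    also have "\<dots> \<le> k"
      using card_image_le[of "{..<k}" V] by simp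
    finally show ?thesis .
  qed
  have err: "norm ((A - X) *v x) \<le> \<sigma> k * (1 + 2 * t) * norm x" for x
  proof -
    \<comment> \<open>This \<open>y\<close> solves \<open>G y = V1.P x\<close>, so \<open>X\<close>
      reproduces the contribution of \<open>V1.P x\<close> exactly. The error is \<open>A\<close>
      applied to \<open>V2.P x\<close> minus the cross term \<open>d\<close>, a vector in the span
      of \<open>V\<^sub>2\<close>.\<close>
    define y where "y = H (V1.P x)"
    have Gy': "G y + (y - V1.P y) = V1.P x"
      using H[of "V1.P x"] by (simp add: G'_def y_def)
    have "V1.P (y - V1.P y) = 0"
      by (simp add: linear_diff[OF V1.linear_proj] V1.proj_idem)
    then have "V1.P (G y + (y - V1.P y)) = G y"
      by (simp only: linear_add[OF V1.linear_proj] G_proj add_0_right)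
    then have Gy: "G y = V1.P x"
      unfolding Gy' V1.proj_idem by simp
    define d where "d = (\<Sum>j\<in>UNIV. (r (\<omega> j) * (w j \<bullet> y)) *\<^sub>R z j)"
    have "X *v x = (\<Sum>j\<in>UNIV. (r (\<omega> j) * (w j \<bullet> y)) *\<^sub>R (A *v (w j + z j)))"
      unfolding X f_def y_def[symmetric] w_def z_def
      by (subst thin_svd_mult_split[OF svd less_imp_le[OF k]]) simp
    also have "\<dots> = A *v (G y + d)"
      by (simp add: G_def d_def matrix_vector_right_distrib linear_sum[OF matrix_vector_mul_linear]
          linear_scale[OF matrix_vector_mul_linear] scaleR_add_right sum.distrib)
    finally have "X *v x = A *v (V1.P x + d)" by (simp add: Gy)
    moreover have "A *v x = A *v (V1.P x + V2.P x)"
      by (rule thin_svd_mult_split[OF svd less_imp_le[OF k]])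
    ultimately have e: "(A - X) *v x = A *v (V2.P x - d)"
      by (simp add: matrix_vector_mult_diff_rdistrib matrix_vector_right_distrib matrix_vector_mult_diff_distrib)
    have le: "norm (A *v (V2.P x - d)) \<le> \<sigma> k * norm (V2.P x - d)"
    proof (rule norm_mult_tail_le[OF svd k])
      show "V2.P (V2.P x - d) = V2.P x - d"
        by (simp add: d_def linear_diff[OF V2.linear_proj] linear_sum[OF V2.linear_proj]
            linear_scale[OF V2.linear_proj] V2.proj_idem z_proj)
    qed
    have "norm (V2.P x - d) \<le> (1 + 2 * t) * norm x"
    proof -
      have "norm d \<le> t * norm y"
        unfolding d_def by (rule cross)
      also have "\<dots> \<le> t * (2 * norm x)"
        unfolding y_def using norm_H[of "V1.P x"] V1.norm_proj_le[of x] t by (intro mult_left_mono) auto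
      finally show ?thesis
        using norm_triangle_ineq4[of "V2.P x" d] V2.norm_proj_le[of x] by (simp add: algebra_simps)
    qed
    moreover have "0 \<le> \<sigma> k"
      using svd k by (simp add: thin_svd_def)
    ultimately have "\<sigma> k * norm (V2.P x - d) \<le> \<sigma> k * ((1 + 2 * t) * norm x)"
      by (rule mult_left_mono)
    then show ?thesis
      using le unfolding e by (simp only: mult.assoc)
  qed
  have "spectral_norm (A - X) \<le> \<sigma> k * (1 + 2 * t)"
    unfolding spectral_norm_def by (rule onorm_le) (rule err)
  then show ?thesis using cols rank by blast
qed

section \<open>The sampling theorem\<close>

text \<open>The matrix \<open>w z^T\<close>. Under the Frobenius norm such matrices live in a
  Hilbert space, where \<open>vector_bernstein\<close> applies.\<close>

definition outer_product :: "real^'n \<Rightarrow> real^'k \<Rightarrow> real^'k^'n" where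
  "outer_product w z = (\<chi> a. w $ a *\<^sub>R z)"

lemma norm_outer_product: "norm (outer_product w z) = norm w * norm z"
  by (simp add: outer_product_def norm_vec_def[of "\<chi> a. w $ a *\<^sub>R z"] norm_vec_def[of w]
      L2_set_left_distrib)

text \<open>The vector on the left is \<open>M\<^sup>T y\<close>, so this bounds the operator norm
  by the Frobenius norm.\<close>

lemma norm_row_combination_le:
  fixes M :: "real^'k^'n"
  shows "norm (\<Sum>a\<in>UNIV. y $ a *\<^sub>R M $ a) \<le> norm M * norm y"
proof -
  have "norm (\<Sum>a\<in>UNIV. y $ a *\<^sub>R M $ a) \<le> (\<Sum>a\<in>UNIV. \<bar>y $ a\<bar> * \<bar>norm (M $ a)\<bar>)"
    using norm_sum[of "\<lambda>a. y $ a *\<^sub>R M $ a" UNIV] by simp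
  also have "\<dots> \<le> L2_set (\<lambda>a. y $ a) UNIV * L2_set (\<lambda>a. norm (M $ a)) UNIV"
    by (rule L2_set_mult_ineq)
  also have "\<dots> = norm M * norm y"
    by (simp add: norm_vec_def L2_set_def mult.commute)
  finally show ?thesis .
qed

lemma leverage_eq_norm_proj:
  assumes "orthonormal_family V {..<k}"
  shows "leverage V k i = (norm (ortho_proj V {..<k} (axis i 1)))\<^sup>2"
  using orthonormal_family.norm_proj[OF assms]
  by (simp add: leverage_def L2_set_def inner_axis sum_nonneg)

text \<open>Both sides are the trace of the projection. For \<open>V\<^sub>1\<close> this is the sum
  of the leverage scores; for \<open>V\<^sub>2\<close> it enters the variance of the cross
  term.\<close>

lemma sum_norm_proj_axis:
  assumes "orthonormal_family V K"
  shows "(\<Sum>i\<in>UNIV. (norm (ortho_proj V K (axis i (1::real))))\<^sup>2) = real (card K)"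
proof -
  have "(\<Sum>i\<in>UNIV. (norm (ortho_proj V K (axis i (1::real))))\<^sup>2) = (\<Sum>i\<in>UNIV. \<Sum>p\<in>K. (V p $ i)\<^sup>2)"
    by (simp add: orthonormal_family.norm_proj[OF assms] inner_axis)
  also have "\<dots> = (\<Sum>p\<in>K. V p \<bullet> V p)"
    by (subst sum.swap) (simp add: inner_vec_def power2_eq_square)
  also have "\<dots> = real (card K)"
    using orthonormal_family.orthonormal[OF assms] by simp
  finally show ?thesis .
qed

lemma ortho_proj_disjoint:
  assumes "orthonormal_family V I" "K \<subseteq> I" "K' \<subseteq> I" "K \<inter> K' = {}"
  shows "ortho_proj V K (ortho_proj V K' x) = 0"
proof -
  interpret orthonormal_family V I by fact
  have "V p \<bullet> ortho_proj V K' x = 0" if "p \<in> K" for p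
    unfolding ortho_proj_def inner_sum_right
    using that assms by (intro sum.neutral) (auto simp: orthonormal subset_iff disjoint_iff)
  then show ?thesis
    unfolding ortho_proj_def[of V K] by simp
qed

lemma pmf_embed_scores:
  fixes s :: "'n::finite \<Rightarrow> real"
  assumes "admissible lev k s" "1 \<le> k"
  shows "pmf (embed_pmf (\<lambda>i. s i / real k)) i = s i / real k"
proof (rule pmf_embed_pmf)
  show nn: "0 \<le> s i / real k" for i
    using assms by (simp add: admissible_def)
  have "(\<integral>\<^sup>+ i. ennreal (s i / real k) \<partial>count_space UNIV) = ennreal (\<Sum>i\<in>UNIV. s i / real k)"
    using nn by (simp add: nn_integral_count_space_finite sum_ennreal)
  also have "(\<Sum>i\<in>UNIV. s i / real k) = 1"
    using assms by (simp add: admissible_def flip: sum_divide_distrib)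
  finally show "(\<integral>\<^sup>+ i. ennreal (s i / real k) \<partial>count_space UNIV) = 1" by simp
qed

theorem theorem2:
  fixes A :: "real^'n^'m"
    and k \<rho> :: nat
    and U :: "nat \<Rightarrow> real^'m" and \<sigma> :: "nat \<Rightarrow> real" and V :: "nat \<Rightarrow> real^'n"
    and s :: "'n \<Rightarrow> real" and \<delta> :: real
  assumes "rank A = \<rho>"
    and "1 \<le> k" and "k < \<rho>"
    and "k < CARD('l::finite)"
    and "thin_svd A \<rho> U \<sigma> V"
    and "admissible (leverage V k) k s"
    and "0 < \<delta>" and "\<delta> < 1"
  shows "measure_pmf.prob (draws s k :: ('l \<Rightarrow> 'n) pmf)
           {\<omega>. spectral_norm (A - best_approx (sampled_columns A \<omega>) k A)
                 \<le> \<sigma> k * (1 + epsilon (leverage V k) s \<rho> k CARD('l) \<delta>)}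
         \<ge> 1 - \<delta> - 2 * real k * exp (- (real CARD('l) / (8 * real k * c_score (leverage V k) s)))"
proof -
  note k = assms(2,3) and svd = assms(5) and adm = assms(6)
  let ?lev = "leverage V k"
  define l where "l = real CARD('l)"
  define q where "q = embed_pmf (\<lambda>i. s i / real k)"
  define c where "c = c_score ?lev s"
  have l: "0 < l" by (simp add: l_def)
  interpret V: orthonormal_family V "{..<\<rho>}" by (rule thin_svd_orthonormal(2)[OF svd]) simp
  interpret V1: orthonormal_family V "{..<k}" by (rule thin_svd_orthonormal(2)[OF svd]) (use k in auto)
  interpret V2: orthonormal_family V "{k..<\<rho>}" by (rule thin_svd_orthonormal(2)[OF svd]) (use k in auto)

  \<comment> \<open>Projected coordinate vectors and importance weights\<close>
  define w where "w i = V1.P (axis i 1)" for i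
  define z where "z i = V2.P (axis i 1)" for i
  define r where "r i = real k / (l * s i)" for i
  have lev: "?lev i = (norm (w i))\<^sup>2" for i
    unfolding w_def by (rule leverage_eq_norm_proj[OF V1.orthonormal_family_axioms])
  have s_nn: "0 \<le> s i" for i using adm by (simp add: admissible_def)
  have r_nn: "0 \<le> r i" for i using s_nn l by (simp add: r_def)
  have w_zero: "w i = 0" if "s i = 0" for i
  proof -
    have "\<not> 0 < ?lev i" using adm that by (metis admissible_def less_irrefl)
    then show ?thesis by (simp add: lev)
  qed
  have pmf_q: "pmf q i = s i / real k" for i
    unfolding q_def by (rule pmf_embed_scores[OF adm k(1)])
  \<comment> \<open>The weight \<open>r i\<close> is the reciprocal of \<open>l\<close> times the
    probability of \<open>i\<close>, so weighted draws are unbiased for plain sums over all columns.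
    Where \<open>s i = 0\<close>, admissibility forces \<open>w i = 0\<close>, and nothing is
    lost.\<close>
  have weight: "l * (pmf q i * (r i * x)) = x" if "w i = 0 \<Longrightarrow> x = 0" for i x
    using that w_zero[of i] l k by (cases "s i = 0") (auto simp: pmf_q r_def)
  have c_ge: "?lev i / s i \<le> c" for i
    unfolding c_def c_score_def by (rule Max_ge) auto
  have c_pos: "0 < c"
  proof -
    have "(\<Sum>i\<in>UNIV. ?lev i) = real k"
      unfolding lev w_def using sum_norm_proj_axis[OF V1.orthonormal_family_axioms] by simp
    then obtain i where "?lev i \<noteq> 0"
      using k by (metis not_one_le_zero of_nat_0_eq_iff sum.neutral)
    then have "0 < ?lev i" by (simp add: lev)
    then have "0 < ?lev i / s i" using adm by (simp add: admissible_def)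
    then show ?thesis using c_ge[of i] by linarith
  qed
  \<comment> \<open>\<open>R\<close> bounds the squared length of the weighted vector
    \<open>sqrt (r i) *\<^sub>R w i\<close>; the exponent \<open>1 / (8 * R)\<close> becomes
    \<open>l / (8 k c)\<close>.\<close>
  define R where "R = real k * c / l"
  have R: "0 < R" using k c_pos l by (simp add: R_def)
  have r_lev: "r i * (norm (w i))\<^sup>2 \<le> R" for i
    using mult_left_mono[OF c_ge[of i], of "real k / l"] l by (simp add: r_def R_def lev)

  interpret S: rank_one_sampling V "{..<k}" q "\<lambda>i. sqrt (r i) *\<^sub>R w i" "CARD('l)" R
  proof unfold_locales
    show "V1.P (sqrt (r i) *\<^sub>R w i) = sqrt (r i) *\<^sub>R w i" for i
      by (simp add: linear_scale[OF V1.linear_proj] w_def V1.proj_idem)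
    show "(norm (sqrt (r i) *\<^sub>R w i))\<^sup>2 \<le> R" for i
      using r_lev[of i] r_nn[of i] by (simp add: power_mult_distrib)
    show "0 < R" by (rule R)
    fix p p' assume p: "p \<in> {..<k}" "p' \<in> {..<k}"
    have Vw: "V p'' \<bullet> w i = V p'' $ i" if "p'' \<in> {..<k}" for p'' i
      using that by (simp only: w_def V1.inner_basis_proj inner_axis) simp
    have "real CARD('l) * (\<Sum>i\<in>UNIV. pmf q i * ((V p \<bullet> sqrt (r i) *\<^sub>R w i) * (V p' \<bullet> sqrt (r i) *\<^sub>R w i)))
        = (\<Sum>i\<in>UNIV. l * (pmf q i * (r i * ((V p \<bullet> w i) * (V p' \<bullet> w i)))))"
      unfolding sum_distrib_left l_def
    proof (rule sum.cong)
      fix i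
      have "(V p \<bullet> sqrt (r i) *\<^sub>R w i) * (V p' \<bullet> sqrt (r i) *\<^sub>R w i)
          = (sqrt (r i) * sqrt (r i)) * ((V p \<bullet> w i) * (V p' \<bullet> w i))" by simp
      then show "real CARD('l) * (pmf q i * ((V p \<bullet> sqrt (r i) *\<^sub>R w i) * (V p' \<bullet> sqrt (r i) *\<^sub>R w i)))
          = real CARD('l) * (pmf q i * (r i * ((V p \<bullet> w i) * (V p' \<bullet> w i))))"
        using r_nn[of i] by simp
    qed simp
    also have "\<dots> = (\<Sum>i\<in>UNIV. (V p \<bullet> w i) * (V p' \<bullet> w i))"
      by (intro sum.cong weight) auto
    also have "\<dots> = V p \<bullet> V p'"
      by (simp only: Vw p) (simp add: inner_vec_def)
    finally show "real CARD('l) * (\<Sum>i\<in>UNIV. pmf q i * ((V p \<bullet> sqrt (r i) *\<^sub>R w i) * (V p' \<bullet> sqrt (r i) *\<^sub>R w i)))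
        = (if p = p' then 1 else 0)"
      using p by (simp add: V1.orthonormal)
  qed

  \<comment> \<open>Bernstein parameters of the cross term\<close>
  define Z where "Z i = r i *\<^sub>R outer_product (w i) (z i)" for i
  define \<nu> where "\<nu> = R * (real \<rho> + 1 - real k)"
  define L where "L = q_score ?lev s * real k / l"
  define u where "u = ln (real \<rho> / \<delta>)"
  define t where "t = sqrt (2 * \<nu> * u) + L * u / 3"
  have \<rho>: "2 \<le> real \<rho>" using k by simp
  have u: "0 < u" unfolding u_def using \<rho> assms(7,8) by (intro ln_gt_zero) (simp add: field_simps)
  have \<nu>: "0 < \<nu>" unfolding \<nu>_def using R k by (intro mult_pos_pos) auto
  have norm_z: "norm (z i) \<le> 1" for i
    unfolding z_def using V2.norm_proj_le[of "axis i 1"] by simp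
  have norm_Z: "norm (Z i) = r i * (norm (w i) * norm (z i))" for i
    using r_nn[of i] by (simp add: Z_def norm_outer_product)
  have bound: "norm (Z i) \<le> L" for i
  proof -
    have "sqrt (?lev i) / s i \<le> q_score ?lev s"
      unfolding q_score_def by (rule Max_ge) auto
    then have "real k / l * (norm (w i) / s i) \<le> real k / l * q_score ?lev s"
      using l by (intro mult_left_mono) (auto simp: lev)
    moreover have "norm (Z i) \<le> r i * (norm (w i) * 1)"
      unfolding norm_Z using norm_z r_nn by (intro mult_left_mono) auto
    ultimately show ?thesis by (simp add: r_def L_def mult.commute)
  qed
  then have L: "0 \<le> L" using norm_ge_zero order_trans by blast
  \<comment> \<open>After reweighting, \<open>l\<close> times the mean is the sum of all
    \<open>w\<^sub>i z\<^sub>i\<^sup>T\<close>. This is the product of the projections onto the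
    spans of \<open>V\<^sub>1\<close> and \<open>V\<^sub>2\<close>, which are orthogonal.\<close>
  have mean: "(\<Sum>i\<in>UNIV. pmf q i *\<^sub>R Z i) = 0"
  proof (subst vec_eq_iff, rule allI, subst vec_eq_iff, rule allI)
    fix a b
    have wz: "w i $ a = V1.P (axis a 1) $ i" "z i $ b = V2.P (axis b 1) $ i" for i
      using V1.proj_sym[of "axis i 1" "axis a 1"] V2.proj_sym[of "axis i 1" "axis b 1"]
      by (simp_all add: w_def z_def inner_axis inner_commute[of "axis i 1"])
    have "l * (\<Sum>i\<in>UNIV. pmf q i *\<^sub>R Z i) $ a $ b = (\<Sum>i\<in>UNIV. l * (pmf q i * (r i * (w i $ a * z i $ b))))"
      by (simp add: Z_def outer_product_def sum_distrib_left mult.assoc)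
    also have "\<dots> = (\<Sum>i\<in>UNIV. w i $ a * z i $ b)"
      by (intro sum.cong weight) auto
    also have "\<dots> = V1.P (axis a 1) \<bullet> V2.P (axis b 1)"
      unfolding wz by (simp add: inner_vec_def)
    also have "\<dots> = axis a 1 \<bullet> V1.P (V2.P (axis b 1))"
      by (rule V1.proj_sym)
    also have "V1.P (V2.P (axis b 1)) = 0"
      by (rule ortho_proj_disjoint[OF V.orthonormal_family_axioms]) (use k in auto)
    finally show "(\<Sum>i\<in>UNIV. pmf q i *\<^sub>R Z i) $ a $ b = 0 $ a $ b"
      using l by simp
  qed
  \<comment> \<open>One factor \<open>r i\<close> cancels against the probability, the other with
    \<open>(norm (w i))\<^sup>2\<close> is at most \<open>R\<close>, and the remaining squared norms
    of the \<open>z i\<close> sum to the trace \<open>\<rho> - k\<close>.\<close>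
  have var: "real CARD('l) * (\<Sum>i\<in>UNIV. pmf q i * (norm (Z i))\<^sup>2) \<le> \<nu>"
  proof -
    have "real CARD('l) * (\<Sum>i\<in>UNIV. pmf q i * (norm (Z i))\<^sup>2)
        = (\<Sum>i\<in>UNIV. l * (pmf q i * (r i * (r i * (norm (w i))\<^sup>2 * (norm (z i))\<^sup>2))))"
      by (simp add: l_def norm_Z sum_distrib_left power2_eq_square mult_ac)
    also have "\<dots> = (\<Sum>i\<in>UNIV. r i * (norm (w i))\<^sup>2 * (norm (z i))\<^sup>2)"
      by (intro sum.cong weight) auto
    also have "\<dots> \<le> (\<Sum>i\<in>UNIV. R * (norm (z i))\<^sup>2)"
      by (intro sum_mono mult_right_mono r_lev) auto
    also have "\<dots> = R * real (\<rho> - k)"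
      using sum_norm_proj_axis[OF V2.orthonormal_family_axioms] by (simp add: z_def flip: sum_distrib_left)
    also have "\<dots> \<le> \<nu>"
      unfolding \<nu>_def using R k by (intro mult_left_mono) auto
    finally show ?thesis .
  qed

  \<comment> \<open>The two failure events and the union bound\<close>
  let ?M = "draws s k :: ('l \<Rightarrow> 'n) pmf"
  define E1 :: "('l \<Rightarrow> 'n) set" where
    "E1 = {\<omega>. \<exists>x. V1.P x = x \<and> norm x = 1 \<and> (\<Sum>j\<in>UNIV. ((sqrt (r (\<omega> j)) *\<^sub>R w (\<omega> j)) \<bullet> x)\<^sup>2) < 1 / 2}"
  define E2 :: "('l \<Rightarrow> 'n) set" where "E2 = {\<omega>. t < norm (\<Sum>j\<in>UNIV. Z (\<omega> j))}"
  have M: "?M = Pi_pmf UNIV undefined (\<lambda>_. q)"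
    by (simp add: draws_def q_def)
  have P1: "measure_pmf.prob ?M E1 \<le> 2 * real k * exp (- (real CARD('l) / (8 * real k * c)))"
  proof -
    have "measure_pmf.prob ?M E1 \<le> real (card {..<k}) * exp (- (1 / (8 * R)))"
      unfolding M E1_def by (rule S.matrix_chernoff_lower) simp
    also have "1 / (8 * R) = real CARD('l) / (8 * real k * c)"
      using l by (simp add: R_def l_def)
    also have "real (card {..<k}) * exp (- (real CARD('l) / (8 * real k * c)))
        \<le> 2 * real k * exp (- (real CARD('l) / (8 * real k * c)))"
      by (intro mult_right_mono) auto
    finally show ?thesis .
  qed
  have P2: "measure_pmf.prob ?M E2 \<le> \<delta>"
  proof -
    have "measure_pmf.prob ?M E2 \<le> 2 * exp (- u)"
      unfolding M E2_def t_def by (rule vector_bernstein[OF mean bound var \<nu> u])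
    also have "exp (- u) = \<delta> / real \<rho>"
      using \<rho> assms(7) by (simp add: u_def exp_minus inverse_eq_divide)
    also have "2 * (\<delta> / real \<rho>) \<le> \<delta>"
      using \<rho> assms(7) by (simp add: field_simps)
    finally show ?thesis .
  qed
  have t: "0 \<le> t" unfolding t_def using \<nu> u L by auto
  have t_eps: "2 * t \<le> epsilon ?lev s \<rho> k CARD('l) \<delta>"
  proof -
    \<comment> \<open>The constant 3 of \<open>epsilon\<close> arises here:
      \<open>2 * sqrt 2 \<le> 3\<close> serves the variance term and \<open>2 / 3 \<le> 3\<close>
      the term with \<open>L\<close>.\<close>
    have "sqrt 2 \<le> 3 / 2" by (rule real_le_lsqrt) (auto simp: power2_eq_square)
    then have "2 * (sqrt 2 * sqrt (\<nu> * u)) \<le> 3 * sqrt (\<nu> * u)"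
      using mult_right_mono[of "sqrt 2" "3 / 2" "sqrt (\<nu> * u)"] \<nu> u by simp
    moreover have "0 \<le> L * u" using L u by simp
    ultimately have "2 * t \<le> 3 * (sqrt (\<nu> * u) + L * u)"
      by (simp add: t_def mult.assoc real_sqrt_mult)
    also have "\<nu> * u = c * (real k * (real \<rho> + 1 - real k) * ln (real \<rho> / \<delta>) / real CARD('l))"
      by (simp add: \<nu>_def R_def u_def l_def)
    also have "L * u = q_score ?lev s * (real k * ln (real \<rho> / \<delta>) / real CARD('l))"
      by (simp add: L_def u_def l_def)
    finally show ?thesis by (simp add: epsilon_def c_def)
  qed
  have good: "spectral_norm (A - best_approx (sampled_columns A \<omega>) k A)
      \<le> \<sigma> k * (1 + epsilon ?lev s \<rho> k CARD('l) \<delta>)" if \<omega>: "\<omega> \<notin> E1" "\<omega> \<notin> E2" for \<omega>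
  proof -
    have gram: "(norm x)\<^sup>2 / 2 \<le> (\<Sum>j\<in>UNIV. r (\<omega> j) * (w (\<omega> j) \<bullet> x)\<^sup>2)" if x: "V1.P x = x" for x
    proof (cases "x = 0")
      case False
      define y where "y = x /\<^sub>R norm x"
      have y: "V1.P y = y" "norm y = 1" "x = norm x *\<^sub>R y"
        using False x by (auto simp: y_def linear_scale[OF V1.linear_proj])
      have "1 / 2 \<le> (\<Sum>j\<in>UNIV. ((sqrt (r (\<omega> j)) *\<^sub>R w (\<omega> j)) \<bullet> y)\<^sup>2)"
        using \<omega>(1) y by (force simp: E1_def not_less)
      also have "\<dots> = (\<Sum>j\<in>UNIV. r (\<omega> j) * (w (\<omega> j) \<bullet> y)\<^sup>2)"
        using r_nn by (simp add: power_mult_distrib)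
      finally have "(norm x)\<^sup>2 * (1 / 2) \<le> (norm x)\<^sup>2 * (\<Sum>j\<in>UNIV. r (\<omega> j) * (w (\<omega> j) \<bullet> y)\<^sup>2)"
        by (intro mult_left_mono) auto
      also have "\<dots> = (\<Sum>j\<in>UNIV. r (\<omega> j) * (w (\<omega> j) \<bullet> x)\<^sup>2)"
        unfolding sum_distrib_left
      proof (rule sum.cong)
        fix j
        have "w (\<omega> j) \<bullet> x = norm x * (w (\<omega> j) \<bullet> y)"
          using inner_scaleR_right[of "w (\<omega> j)" "norm x" y] y(3) by simp
        then show "(norm x)\<^sup>2 * (r (\<omega> j) * (w (\<omega> j) \<bullet> y)\<^sup>2) = r (\<omega> j) * (w (\<omega> j) \<bullet> x)\<^sup>2"
          by (simp add: power_mult_distrib)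
      qed simp
      finally show ?thesis by simp
    qed simp
    have cross: "norm (\<Sum>j\<in>UNIV. (r (\<omega> j) * (w (\<omega> j) \<bullet> y)) *\<^sub>R z (\<omega> j)) \<le> t * norm y" for y
    proof -
      \<comment> \<open>The cross term at \<open>y\<close> is the transpose of the sum of the
        \<open>Z (\<omega> j)\<close> applied to \<open>y\<close>, so its norm is controlled by the
        Frobenius norm of that sum.\<close>
      have "(\<Sum>j\<in>UNIV. (r (\<omega> j) * (w (\<omega> j) \<bullet> y)) *\<^sub>R z (\<omega> j))
          = (\<Sum>j\<in>UNIV. \<Sum>a\<in>UNIV. y $ a *\<^sub>R Z (\<omega> j) $ a)"
        by (simp add: Z_def outer_product_def inner_vec_def sum_distrib_left scaleR_sum_left mult_ac)
      also have "\<dots> = (\<Sum>a\<in>UNIV. y $ a *\<^sub>R (\<Sum>j\<in>UNIV. Z (\<omega> j)) $ a)"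
        by (subst sum.swap) (simp add: scaleR_sum_right)
      finally have "norm (\<Sum>j\<in>UNIV. (r (\<omega> j) * (w (\<omega> j) \<bullet> y)) *\<^sub>R z (\<omega> j))
          \<le> norm (\<Sum>j\<in>UNIV. Z (\<omega> j)) * norm y"
        using norm_row_combination_le[of y "\<Sum>j\<in>UNIV. Z (\<omega> j)"] by simp
      also have "\<dots> \<le> t * norm y"
        using \<omega>(2) by (intro mult_right_mono) (auto simp: E2_def)
      finally show ?thesis .
    qed
    obtain X where X: "columns X \<subseteq> span (columns (sampled_columns A \<omega>))" "rank X \<le> k"
      "spectral_norm (A - X) \<le> \<sigma> k * (1 + 2 * t)"
      using sampled_approx_exists[OF svd k(2) t, where \<omega> = \<omega> and r = r] gram cross unfolding w_def z_def by blast
    have "spectral_norm (A - best_approx (sampled_columns A \<omega>) k A) \<le> \<sigma> k * (1 + 2 * t)"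
      using best_approx_le[OF X(1,2), of A] X(3) by simp
    also have "\<dots> \<le> \<sigma> k * (1 + epsilon ?lev s \<rho> k CARD('l) \<delta>)"
      using svd k t_eps by (intro mult_left_mono) (auto simp: thin_svd_def)
    finally show ?thesis .
  qed
  let ?G = "{\<omega>. spectral_norm (A - best_approx (sampled_columns A \<omega>) k A)
                 \<le> \<sigma> k * (1 + epsilon ?lev s \<rho> k CARD('l) \<delta>)}"
  have "1 - measure_pmf.prob ?M ?G = measure_pmf.prob ?M (- ?G)"
    using measure_pmf.prob_compl[of ?G ?M] by (simp add: Compl_eq_Diff_UNIV)
  also have "\<dots> \<le> measure_pmf.prob ?M (E1 \<union> E2)"
    using good by (intro measure_pmf.finite_measure_mono) auto
  also have "\<dots> \<le> measure_pmf.prob ?M E1 + measure_pmf.prob ?M E2"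
    by (rule measure_Un_le) auto
  finally show ?thesis
    using P1 P2 unfolding c_def by linarith
qed

end
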